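(* Let $K$ be a field of characteristic zero. For $n\geq 2$, $\mathfrak{div}_n^c$ is a maximal Lie subalgebra of $D_n$. For $n=1$, $\mathfrak{div}_1^c$ is not a maximal Lie subalgebra of $D_1$. For each $n\geq 1$, $\mathfrak{div}_n^c$ is a Lie subalgebra of $D_n$ that is invariant under the group $\mathbb{G}_n=\mathrm{Aut}_{\mathrm{Lie}}(D_n)$ and under the group $G_n=\mathrm{Aut}_{K\text{-alg}}(P_n)$.
   Context: $P_n=K[x_1,\ldots,x_n]$, $\partial_i=\partial/\partial x_i$, $D_n=\mathrm{Der}_K(P_n)=\bigoplus_{i=1}^n P_n\partial_i$ with bracket $[\partial,\delta]=\partial\delta-\delta\partial$. For $\partial=\sum_{i=1}^n a_i\partial_i\in D_n$, $\mathrm{div}(\partial)=\sum_{i=1}^n \partial a_i/\partial x_i$, and $\mathfrak{div}_n^c=\{\partial\in D_n : \mathrm{div}(\partial)\in K\}$. The group $G_n$ acts on $D_n$ by $\sigma(\partial)=\sigma\partial\sigma^{-1}$. A Lie subalgebra $\mathcal{M}$ of a Lie algebra $\mathcal{G}$ is maximal if $\mathcal{M}\neq\mathcal{G}$ and $\mathcal{G}$ is the only Lie subalgebra of $\mathcal{G}$ properly containing $\mathcal{M}$. *)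

theory Defs
  imports Complex_Main "HOL-Library.Poly_Mapping" "HOL-Library.Function_Algebras"
    "HOL-Library.Cardinality"
begin

text \<open>
  The polynomial algebra over \<open>'k\<close> in the variables indexed by \<open>'n\<close>: finitely supported
  coefficient functions on exponent vectors, multiplied by convolution. The number of
  variables is \<open>CARD('n)\<close>.
\<close>

type_synonym ('n, 'k) mpoly = "('n \<Rightarrow>\<^sub>0 nat) \<Rightarrow>\<^sub>0 'k"
type_synonym ('n, 'k) mpoly_endo = "('n, 'k) mpoly \<Rightarrow> ('n, 'k) mpoly"

definition const :: "'k::field_char_0 \<Rightarrow> ('n, 'k) mpoly" where
  "const c = Poly_Mapping.single 0 c"

definition var :: "'n \<Rightarrow> ('n, 'k::field_char_0) mpoly" where
  "var i = Poly_Mapping.single (Poly_Mapping.single i 1) 1"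

definition pscale :: "'k::field_char_0 \<Rightarrow> ('n, 'k) mpoly \<Rightarrow> ('n, 'k) mpoly" where
  "pscale c p = const c * p"

definition escale :: "'k::field_char_0 \<Rightarrow> ('n, 'k) mpoly_endo \<Rightarrow> ('n, 'k) mpoly_endo" where
  "escale c f = (\<lambda>p. pscale c (f p))"

text \<open>
  Exponents are subtracted in \<open>nat\<close>; the truncation only affects monomials not involving the
  variable \<open>i\<close>, whose derivative has coefficient 0.
\<close>

definition partial_deriv :: "'n \<Rightarrow> ('n, 'k::field_char_0) mpoly_endo" where
  "partial_deriv i p = (\<Sum>m\<in>Poly_Mapping.keys p.
     Poly_Mapping.single (m - Poly_Mapping.single i 1)
       (of_nat (poly_mapping.lookup m i) * poly_mapping.lookup p m))"

definition derivations :: "('n::finite, 'k::field_char_0) mpoly_endo set" where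
  "derivations = {\<delta>. Vector_Spaces.linear pscale pscale \<delta> \<and>
     (\<forall>p q. \<delta> (p * q) = \<delta> p * q + p * \<delta> q)}"

text \<open>
  The coefficient of \<open>partial_deriv i\<close> in a derivation \<open>\<delta>\<close> is \<open>\<delta> (var i)\<close>; see
  \<open>derivations_eq\<close> and \<open>divergence_sum\<close> below.
\<close>

definition divergence :: "('n::finite, 'k::field_char_0) mpoly_endo \<Rightarrow> ('n, 'k) mpoly" where
  "divergence \<delta> = (\<Sum>i\<in>UNIV. partial_deriv i (\<delta> (var i)))"

definition const_div_derivations :: "('n::finite, 'k::field_char_0) mpoly_endo set" where
  "const_div_derivations = {\<delta> \<in> derivations. divergence \<delta> \<in> range const}"

definition commutator ::
    "('n, 'k::field_char_0) mpoly_endo \<Rightarrow> ('n, 'k) mpoly_endo \<Rightarrow> ('n, 'k) mpoly_endo" where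
  "commutator f g = (f \<circ> g) - (g \<circ> f)"

text \<open>All Lie algebras here consist of endomaps of the polynomial algebra, under the commutator.\<close>

definition lie_subalgebra ::
    "('n, 'k::field_char_0) mpoly_endo set \<Rightarrow> ('n, 'k) mpoly_endo set \<Rightarrow> bool" where
  "lie_subalgebra M G \<longleftrightarrow> M \<subseteq> G \<and> module.subspace escale M \<and>
     (\<forall>f\<in>M. \<forall>g\<in>M. commutator f g \<in> M)"

definition maximal_lie_subalgebra ::
    "('n, 'k::field_char_0) mpoly_endo set \<Rightarrow> ('n, 'k) mpoly_endo set \<Rightarrow> bool" where
  "maximal_lie_subalgebra M G \<longleftrightarrow> lie_subalgebra M G \<and> M \<noteq> G \<and>
     (\<forall>N. lie_subalgebra N G \<and> M \<subset> N \<longrightarrow> N = G)"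

definition lie_automorphisms ::
    "('n, 'k::field_char_0) mpoly_endo set \<Rightarrow> (('n, 'k) mpoly_endo \<Rightarrow> ('n, 'k) mpoly_endo) set"
  where
  "lie_automorphisms G = {\<phi>. bij_betw \<phi> G G \<and>
     (\<forall>f\<in>G. \<forall>g\<in>G. \<phi> (f + g) = \<phi> f + \<phi> g) \<and>
     (\<forall>c. \<forall>f\<in>G. \<phi> (escale c f) = escale c (\<phi> f)) \<and>
     (\<forall>f\<in>G. \<forall>g\<in>G. \<phi> (commutator f g) = commutator (\<phi> f) (\<phi> g))}"

definition poly_automorphisms :: "('n, 'k::field_char_0) mpoly_endo set" where
  "poly_automorphisms = {\<sigma>. bij \<sigma> \<and> Vector_Spaces.linear pscale pscale \<sigma> \<and>
     \<sigma> 1 = 1 \<and> (\<forall>p q. \<sigma> (p * q) = \<sigma> p * \<sigma> q)}"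

definition conj_action ::
    "('n, 'k::field_char_0) mpoly_endo \<Rightarrow> ('n, 'k) mpoly_endo \<Rightarrow> ('n, 'k) mpoly_endo" where
  "conj_action \<sigma> \<delta> = \<sigma> \<circ> \<delta> \<circ> inv \<sigma>"

lemma commutator_apply: "commutator f g p = f (g p) - g (f p)"
  by (simp add: commutator_def)

lemma const_add: "const (a + b) = const a + const b"
  by (simp add: const_def single_add)

lemma const_mult: "const (a * b) = const a * const b"
  by (simp add: const_def mult_single)

lemma const_1 [simp]: "const 1 = 1"
  by (simp add: const_def)

global_interpretation poly_space: vector_space pscale
  by unfold_locales (simp_all add: pscale_def const_add const_mult algebra_simps)

global_interpretation endo_space: vector_space escale
  by unfold_locales (simp_all add: escale_def fun_eq_iff poly_space.scale_right_distrib
      poly_space.scale_left_distrib)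

lemma poly_linear_iff:
  "Vector_Spaces.linear pscale pscale f \<longleftrightarrow>
     (\<forall>p q. f (p + q) = f p + f q) \<and> (\<forall>c p. f (pscale c p) = pscale c (f p))"
  by (simp add: Vector_Spaces.linear_def module_hom_def module_hom_axioms_def
      poly_space.vector_space_axioms poly_space.module_axioms)

lemma pscale_single: "pscale c (Poly_Mapping.single m a) = Poly_Mapping.single m (c * a)"
  by (simp add: pscale_def const_def mult_single)

lemma lookup_pscale: "poly_mapping.lookup (pscale c p) m = c * poly_mapping.lookup p m"
proof -
  have "poly_mapping.lookup (Poly_Mapping.map ((*) c) p) m = c * poly_mapping.lookup p m"
    by (simp add: Poly_Mapping.map.rep_eq when_def)
  then show ?thesis
    by (simp add: mult_map_scale_conv_mult pscale_def const_def)
qed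

lemma mpoly_expand:
  fixes p :: "('n, 'k::field_char_0) mpoly"
  shows "p = (\<Sum>m\<in>Poly_Mapping.keys p. Poly_Mapping.single m (poly_mapping.lookup p m))"
proof (rule poly_mapping_eqI)
  fix k
  show "poly_mapping.lookup p k = poly_mapping.lookup
      (\<Sum>m\<in>Poly_Mapping.keys p. Poly_Mapping.single m (poly_mapping.lookup p m)) k"
    by (simp add: lookup_sum lookup_single when_def in_keys_iff)
qed

lemma mpoly_induct [case_names add single]:
  fixes p :: "('n, 'k::field_char_0) mpoly"
  assumes "\<And>p q. P p \<Longrightarrow> P q \<Longrightarrow> P (p + q)" and "\<And>m c. P (Poly_Mapping.single m c)"
  shows "P p"
proof -
  have "P 0"
    using assms(2)[of 0 0] by simp
  have "P (\<Sum>m\<in>A. Poly_Mapping.single m (poly_mapping.lookup p m))" if "finite A" for A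
    using that by induction (simp_all add: assms \<open>P 0\<close>)
  from this[OF finite_keys[of p]] show ?thesis
    by (simp only: mpoly_expand[symmetric])
qed

lemma lookup_partial_deriv:
  "poly_mapping.lookup (partial_deriv i p) m =
     of_nat (poly_mapping.lookup m i + 1) * poly_mapping.lookup p (m + Poly_Mapping.single i 1)"
proof -
  let ?s = "Poly_Mapping.single i (1::nat)"
  have shift: "k = m + ?s" if "k - ?s = m" "poly_mapping.lookup k i \<noteq> 0" for k
  proof (rule poly_mapping_eqI)
    fix j
    show "poly_mapping.lookup k j = poly_mapping.lookup (m + ?s) j"
      using that by (auto simp: lookup_add lookup_minus lookup_single when_def)
  qed
  have "poly_mapping.lookup (partial_deriv i p) m =
      (\<Sum>k\<in>Poly_Mapping.keys p. if k - ?s = m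
        then of_nat (poly_mapping.lookup k i) * poly_mapping.lookup p k else 0)"
    by (simp add: partial_deriv_def lookup_sum lookup_single when_def)
  also have "\<dots> = (\<Sum>k\<in>Poly_Mapping.keys p. if k = m + ?s
        then of_nat (poly_mapping.lookup k i) * poly_mapping.lookup p k else 0)"
    using shift by (intro sum.cong refl) auto
  also have "\<dots> = of_nat (poly_mapping.lookup (m + ?s) i) * poly_mapping.lookup p (m + ?s)"
    by (simp add: in_keys_iff)
  finally show ?thesis
    by (simp add: lookup_add)
qed

lemma partial_deriv_single:
  "partial_deriv i (Poly_Mapping.single m c) =
     Poly_Mapping.single (m - Poly_Mapping.single i 1) (of_nat (poly_mapping.lookup m i) * c)"
  by (simp add: partial_deriv_def)

lemma partial_deriv_add: "partial_deriv i (p + q) = partial_deriv i p + partial_deriv i q"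
  by (rule poly_mapping_eqI) (simp add: lookup_partial_deriv lookup_add algebra_simps)

lemma partial_deriv_pscale: "partial_deriv i (pscale c p) = pscale c (partial_deriv i p)"
  by (rule poly_mapping_eqI) (simp add: lookup_partial_deriv lookup_pscale)

lemma partial_deriv_mult_single:
  "partial_deriv i (Poly_Mapping.single m a * Poly_Mapping.single k b) =
     partial_deriv i (Poly_Mapping.single m a) * Poly_Mapping.single k b +
     Poly_Mapping.single m a * partial_deriv i (Poly_Mapping.single k b)"
proof -
  let ?s = "Poly_Mapping.single i (1::nat)"
  have shift: "(u - ?s) + v = u + v - ?s" if "poly_mapping.lookup u i \<noteq> 0" for u v
    by (rule poly_mapping_eqI)
      (use that in \<open>auto simp: lookup_add lookup_minus lookup_single when_def\<close>)
  have 1: "Poly_Mapping.single ((m - ?s) + k) (of_nat (poly_mapping.lookup m i) * a * b) =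
      Poly_Mapping.single (m + k - ?s) (of_nat (poly_mapping.lookup m i) * a * b)"
    using shift[of m k] by (cases "poly_mapping.lookup m i = 0") auto
  have 2: "Poly_Mapping.single (m + (k - ?s)) (a * (of_nat (poly_mapping.lookup k i) * b)) =
      Poly_Mapping.single (m + k - ?s) (a * (of_nat (poly_mapping.lookup k i) * b))"
    using shift[of k m] by (cases "poly_mapping.lookup k i = 0") (auto simp: add.commute)
  show ?thesis
    unfolding mult_single partial_deriv_single 1 2
    by (simp add: single_add[symmetric] lookup_add algebra_simps)
qed

lemma partial_deriv_mult:
  "partial_deriv i (p * q) = partial_deriv i p * q + p * partial_deriv i q"
proof (induction p rule: mpoly_induct)
  case (add p p')
  then show ?case by (simp add: partial_deriv_add algebra_simps)
next
  case (single m c)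
  show ?case
  proof (induction q rule: mpoly_induct)
    case (add q q')
    then show ?case by (simp add: partial_deriv_add algebra_simps)
  next
    case (single k d)
    show ?case by (rule partial_deriv_mult_single)
  qed
qed

lemma partial_deriv_var: "partial_deriv i (var j) = (if i = j then 1 else 0)"
  by (simp add: var_def partial_deriv_single lookup_single when_def)

lemma derivation_1:
  assumes "\<delta> \<in> derivations" shows "\<delta> 1 = 0"
proof -
  have "\<delta> (1 * 1) = \<delta> 1 * 1 + 1 * \<delta> 1"
    using assms unfolding derivations_def by blast
  then show ?thesis by simp
qed

lemma sum_partial_deriv_derivation:
  "(\<lambda>p. \<Sum>i\<in>UNIV. a i * partial_deriv i p) \<in> derivations"
proof -
  have "(\<Sum>i\<in>UNIV. a i * partial_deriv i (p * q)) =
      (\<Sum>i\<in>UNIV. a i * partial_deriv i p) * q + p * (\<Sum>i\<in>UNIV. a i * partial_deriv i q)" for p q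
    by (simp add: partial_deriv_mult sum_distrib_left sum_distrib_right sum.distrib[symmetric]
        algebra_simps)
  moreover have "(\<Sum>i\<in>UNIV. a i * partial_deriv i (pscale c p)) =
      pscale c (\<Sum>i\<in>UNIV. a i * partial_deriv i p)" for c p
    by (simp add: partial_deriv_pscale) (simp add: pscale_def sum_distrib_left algebra_simps)
  ultimately show ?thesis
    by (simp add: derivations_def poly_linear_iff partial_deriv_add sum.distrib algebra_simps)
qed

lemma derivation_diff:
  assumes "\<delta> \<in> derivations" "\<epsilon> \<in> derivations" shows "\<delta> - \<epsilon> \<in> derivations"
  using assms
  by (auto simp: derivations_def poly_linear_iff algebra_simps poly_space.scale_right_diff_distrib)

lemma derivation_eq_0:
  assumes d: "\<delta> \<in> derivations" and v: "\<And>i. \<delta> (var i) = 0"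
  shows "\<delta> p = 0"
proof -
  have lin: "\<delta> (p + q) = \<delta> p + \<delta> q" "\<delta> (pscale c p) = pscale c (\<delta> p)"
    and leib: "\<delta> (p * q) = \<delta> p * q + p * \<delta> q" for c p q
    using d by (auto simp: derivations_def poly_linear_iff)
  have mon: "\<delta> (Poly_Mapping.single m 1) = 0" for m
  proof (induction "\<Sum>i\<in>UNIV. poly_mapping.lookup m i" arbitrary: m rule: less_induct)
    case less
    show ?case
    proof (cases "m = 0")
      case True
      then show ?thesis using derivation_1[OF d] by simp
    next
      case False
      then obtain i where i: "poly_mapping.lookup m i \<noteq> 0"
        by (metis lookup_zero poly_mapping_eqI)
      let ?s = "Poly_Mapping.single i (1::nat)"
      have m: "m = ?s + (m - ?s)"
        by (rule poly_mapping_eqI)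
            (use i in \<open>auto simp: lookup_add lookup_minus lookup_single when_def\<close>)
      have "(\<Sum>j\<in>UNIV. poly_mapping.lookup (m - ?s) j) < (\<Sum>j\<in>UNIV. poly_mapping.lookup m j)"
        by (rule sum_strict_mono_ex1)
            (use i in \<open>auto simp: lookup_minus lookup_single when_def\<close>)
      then have "\<delta> (Poly_Mapping.single (m - ?s) 1) = 0"
        by (rule less)
      moreover have "Poly_Mapping.single m (1::'b) = var i * Poly_Mapping.single (m - ?s) 1"
        by (subst m) (simp only: var_def mult_single mult_1)
      ultimately show ?thesis
        by (simp add: leib v)
    qed
  qed
  show ?thesis
  proof (induction p rule: mpoly_induct)
    case (add p q)
    then show ?case by (simp add: lin)
  next
    case (single m c)
    have "Poly_Mapping.single m c = pscale c (Poly_Mapping.single m 1)"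
      by (simp add: pscale_single)
    then show ?case by (simp add: lin mon)
  qed
qed

lemma derivation_expand:
  assumes d: "\<delta> \<in> derivations"
  shows "\<delta> = (\<lambda>p. \<Sum>i\<in>UNIV. \<delta> (var i) * partial_deriv i p)"
proof
  fix p
  let ?e = "\<lambda>p. \<Sum>i\<in>UNIV. \<delta> (var i) * partial_deriv i p"
  have "(\<delta> - ?e) p = 0"
  proof (rule derivation_eq_0[where \<delta> = "\<delta> - ?e"])
    show "\<delta> - ?e \<in> derivations"
      by (intro derivation_diff d sum_partial_deriv_derivation)
    show "(\<delta> - ?e) (var i) = 0" for i
      by (simp add: partial_deriv_var if_distrib cong: if_cong)
  qed
  then show "\<delta> p = ?e p" by simp
qed

lemma derivations_eq:
  "derivations = range (\<lambda>a p. \<Sum>i\<in>UNIV. a i * partial_deriv i p)"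
proof
  show "derivations \<subseteq> range (\<lambda>a p. \<Sum>i\<in>UNIV. a i * partial_deriv i p)"
    by (rule subsetI, rule image_eqI, erule derivation_expand, rule UNIV_I)
  show "range (\<lambda>a p. \<Sum>i\<in>UNIV. a i * partial_deriv i p) \<subseteq> derivations"
    by (auto intro: sum_partial_deriv_derivation)
qed

lemma divergence_sum:
  "divergence (\<lambda>p. \<Sum>i\<in>UNIV. a i * partial_deriv i p) = (\<Sum>i\<in>UNIV. partial_deriv i (a i))"
  by (simp add: divergence_def partial_deriv_var if_distrib cong: if_cong)

lemma lie_subalgebra_derivations:
  "lie_subalgebra (derivations :: ('n::finite, 'k::field_char_0) mpoly_endo set) derivations"
proof -
  have "commutator f g \<in> derivations" if "f \<in> derivations" "g \<in> derivations" for f g :: "('n, 'k) mpoly_endo"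
  proof -
    have lin: "f (p + q) = f p + f q" "f (pscale c p) = pscale c (f p)"
        "g (p + q) = g p + g q" "g (pscale c p) = pscale c (g p)"
      and leib: "f (p * q) = f p * q + p * f q" "g (p * q) = g p * q + p * g q" for c p q
      using that by (auto simp: derivations_def poly_linear_iff)
    have "commutator f g (p + q) = commutator f g p + commutator f g q" for p q
      by (simp add: commutator_def lin)
    moreover have "commutator f g (pscale c p) = pscale c (commutator f g p)" for c p
      by (simp add: commutator_def lin poly_space.scale_right_diff_distrib)
    moreover have "commutator f g (p * q) = commutator f g p * q + p * commutator f g q" for p q
      by (simp add: commutator_def lin leib) (simp add: algebra_simps)
    ultimately show ?thesis
      unfolding derivations_def poly_linear_iff by blast
  qed
  moreover have "escale c f \<in> derivations" if "f \<in> derivations" for c and f :: "('n, 'k) mpoly_endo"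
    using that
    by (auto simp: derivations_def poly_linear_iff escale_def pscale_def algebra_simps)
  moreover have "f + g \<in> derivations" if "f \<in> derivations" "g \<in> derivations" for f g :: "('n, 'k) mpoly_endo"
    using that
    by (auto simp: derivations_def poly_linear_iff algebra_simps poly_space.scale_right_distrib)
  moreover have "(0 :: ('n, 'k) mpoly_endo) \<in> derivations"
    by (auto simp: derivations_def poly_linear_iff)
  ultimately show ?thesis
    by (simp add: lie_subalgebra_def endo_space.subspace_def)
qed

end

theory Submission
  imports "HOL-Analysis.Determinants" Defs
begin

text \<open>
  An automorphism of the Lie algebra of derivations preserves the set of locally ad-nilpotent
  elements. These have divergence 0, and the fields \<open>c * partial_deriv i\<close> with \<open>c\<close> independent of
  \<open>i\<close> are among them and generate the divergence-free derivations. So the latter form an invariant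
  subalgebra, and its normalizer is the algebra of derivations with constant divergence.
  Conjugation by a polynomial automorphism is a special case.

  For maximality, the divergences of a larger subalgebra form a subspace stable under all
  divergence-free derivations and containing a non-constant polynomial. Partial derivatives
  produce a polynomial of degree one in it, then the fields \<open>u * partial_deriv i\<close> with \<open>u\<close>
  independent of \<open>i\<close> produce all variables and, from these, all monomials.
\<close>

section \<open>Derivations and divergence\<close>

lemma
  assumes "\<delta> \<in> derivations"
  shows derivation_add: "\<delta> (p + q) = \<delta> p + \<delta> q"
    and derivation_pscale: "\<delta> (pscale c p) = pscale c (\<delta> p)"
    and derivation_mult: "\<delta> (p * q) = \<delta> p * q + p * \<delta> q"
  using assms by (auto simp: derivations_def poly_linear_iff)

lemma derivation_0:
  assumes "\<delta> \<in> derivations" shows "\<delta> 0 = 0"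
  using derivation_add[OF assms, of 0 0] by simp

lemma derivation_minus:
  assumes "\<delta> \<in> derivations" shows "\<delta> (- p) = - \<delta> p"
  using derivation_add[OF assms, of p "- p"] derivation_0[OF assms]
  by (simp add: eq_neg_iff_add_eq_0 add.commute)

lemma derivation_diff_apply:
  assumes "\<delta> \<in> derivations" shows "\<delta> (p - q) = \<delta> p - \<delta> q"
  using derivation_add[OF assms, of p "- q"] derivation_minus[OF assms] by simp

lemma derivation_sum:
  assumes "\<delta> \<in> derivations" shows "\<delta> (sum f A) = (\<Sum>x\<in>A. \<delta> (f x))"
  by (induction A rule: infinite_finite_induct)
    (simp_all add: derivation_0[OF assms] derivation_add[OF assms])

lemma derivation_const:
  assumes "\<delta> \<in> derivations" shows "\<delta> (const c) = 0"
  using derivation_pscale[OF assms, of c 1] derivation_1[OF assms] by (simp add: pscale_def)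

lemma derivation_of_nat:
  assumes "\<delta> \<in> derivations" shows "\<delta> (of_nat k) = 0"
  by (induction k) (simp_all add: derivation_0[OF assms] derivation_1[OF assms] derivation_add[OF assms])

lemma derivation_apply:
  assumes "\<delta> \<in> derivations"
  shows "\<delta> p = (\<Sum>i\<in>UNIV. \<delta> (var i) * partial_deriv i p)"
  by (rule fun_cong[OF derivation_expand[OF assms]])

lemma derivation_eqI:
  assumes "\<delta> \<in> derivations" "\<epsilon> \<in> derivations" "\<And>i. \<delta> (var i) = \<epsilon> (var i)"
  shows "\<delta> = \<epsilon>"
proof
  show "\<delta> p = \<epsilon> p" for p
    by (simp add: assms(3) derivation_apply[OF assms(1), of p] derivation_apply[OF assms(2), of p])
qed

lemmas derivations_lie = lie_subalgebra_derivations[unfolded lie_subalgebra_def,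
    THEN conjunct2, THEN conjunct1] lie_subalgebra_derivations[unfolded lie_subalgebra_def,
    THEN conjunct2, THEN conjunct2, rule_format]

lemmas derivation_plus_closed = endo_space.subspace_add[OF derivations_lie(1)]
lemmas derivation_escale_closed = endo_space.subspace_scale[OF derivations_lie(1)]
lemmas derivation_0_closed = endo_space.subspace_0[OF derivations_lie(1)]
lemmas derivation_commutator_closed = derivations_lie(2)

lemma derivation_module_closed:
  assumes "\<delta> \<in> derivations" shows "(\<lambda>p. a * \<delta> p) \<in> derivations"
proof -
  have "(\<lambda>p. a * \<delta> p) = (\<lambda>p. \<Sum>i\<in>UNIV. (a * \<delta> (var i)) * partial_deriv i p)"
    by (rule ext, subst derivation_apply[OF assms]) (simp add: sum_distrib_left mult.assoc)
  then show ?thesis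
    by (simp add: sum_partial_deriv_derivation)
qed

lemma partial_deriv_derivation: "partial_deriv i \<in> derivations"
  by (auto simp: derivations_def poly_linear_iff partial_deriv_add partial_deriv_pscale
      partial_deriv_mult)

lemma partial_deriv_numeral: "partial_deriv (i :: 'n::finite) (numeral k) = 0"
  using derivation_of_nat[OF partial_deriv_derivation, of i "numeral k"] by simp

lemmas partial_deriv_simps =
  partial_deriv_numeral
  derivation_0[OF partial_deriv_derivation] derivation_1[OF partial_deriv_derivation]
  derivation_minus[OF partial_deriv_derivation] derivation_diff_apply[OF partial_deriv_derivation]
  derivation_sum[OF partial_deriv_derivation] derivation_const[OF partial_deriv_derivation]
  partial_deriv_add partial_deriv_mult partial_deriv_var

text \<open>The commutator of two partial derivatives is again a derivation, and it kills every
  variable.\<close>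

lemma partial_deriv_commute:
  fixes p :: "('n::finite, 'k::field_char_0) mpoly"
  shows "partial_deriv i (partial_deriv j p) = partial_deriv j (partial_deriv i p)"
proof -
  have "partial_deriv i (partial_deriv j p) - partial_deriv j (partial_deriv i p) =
      commutator (partial_deriv i) (partial_deriv j) p"
    by (simp add: commutator_apply)
  also have "commutator (partial_deriv i) (partial_deriv j) = 0"
    by (rule derivation_eqI)
      (simp_all add: derivation_commutator_closed partial_deriv_derivation derivation_0_closed
        commutator_apply partial_deriv_simps)
  finally show ?thesis by simp
qed

text \<open>In characteristic zero the coefficient of a monomial involving the variable
  \<open>i\<close> can be recovered from \<open>partial_deriv i p\<close>, where it appears
  multiplied by a positive exponent.\<close>

lemma range_const_iff:
  fixes p :: "('n::finite, 'k::field_char_0) mpoly"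
  shows "p \<in> range const \<longleftrightarrow> (\<forall>i. partial_deriv i p = 0)"
proof
  assume "p \<in> range const"
  then show "\<forall>i. partial_deriv i p = 0"
    by (auto simp: const_def partial_deriv_single)
next
  assume *: "\<forall>i. partial_deriv i p = 0"
  have "poly_mapping.lookup p m = 0" if m0: "m \<noteq> 0" for m
  proof -
    obtain i where i: "poly_mapping.lookup m i \<noteq> 0"
      using m0 by (auto simp: poly_mapping_eq_iff fun_eq_iff)
    let ?s = "Poly_Mapping.single i (1::nat)"
    have m: "m = (m - ?s) + ?s"
      by (rule poly_mapping_eqI)
        (use i in \<open>auto simp: lookup_add lookup_minus lookup_single when_def\<close>)
    have "of_nat (poly_mapping.lookup (m - ?s) i + 1) * poly_mapping.lookup p (m - ?s + ?s) = 0"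
      using * lookup_partial_deriv[of i p "m - ?s"] by simp
    then show ?thesis
      using m by (simp del: of_nat_add of_nat_Suc)
  qed
  then have "p = const (poly_mapping.lookup p 0)"
    by (intro poly_mapping_eqI) (auto simp: const_def lookup_single when_def)
  then show "p \<in> range const" by blast
qed

lemma divergence_add: "divergence (f + g) = divergence f + divergence g"
  by (simp add: divergence_def partial_deriv_add sum.distrib)

lemma divergence_diff: "divergence (f - g) = divergence f - divergence g"
  by (simp add: divergence_def partial_deriv_simps sum_subtractf)

lemma divergence_0: "divergence 0 = 0"
  by (simp add: divergence_def partial_deriv_simps)

lemma divergence_escale: "divergence (escale c f) = pscale c (divergence f)"
  by (simp add: divergence_def escale_def partial_deriv_pscale poly_space.scale_sum_right)

lemma mult_partial_deriv_derivation: "(\<lambda>p. a * partial_deriv i p) \<in> derivations"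
  by (rule derivation_module_closed[OF partial_deriv_derivation])

lemma divergence_mult_partial_deriv: "divergence (\<lambda>p. a * partial_deriv i p) = partial_deriv i a"
proof -
  have "partial_deriv j (a * (if i = j then 1 else 0)) = (if i = j then partial_deriv j a else 0)" for j
    by (simp add: partial_deriv_simps)
  then show ?thesis
    by (simp add: divergence_def partial_deriv_var)
qed

lemma divergence_partial_deriv: "divergence (partial_deriv i) = 0"
  using divergence_mult_partial_deriv[of 1 i] by (simp add: partial_deriv_simps)

text \<open>Moving \<open>partial_deriv i\<close> past \<open>f\<close> or \<open>g\<close> leaves
  sums of products of first derivatives of the coefficients. These sums are the traces of the two
  products of the Jacobian matrices, so they cancel in the difference.\<close>

lemma divergence_commutator:
  assumes f: "f \<in> derivations" and g: "g \<in> derivations"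
  shows "divergence (commutator f g) = f (divergence g) - g (divergence f)"
proof -
  have pd: "partial_deriv i (h p) =
      h (partial_deriv i p) + (\<Sum>j\<in>UNIV. partial_deriv i (h (var j)) * partial_deriv j p)"
    if h: "h \<in> derivations" for h i and p :: "('a, 'b) mpoly"
    by (simp add: derivation_apply[OF h, of p] derivation_apply[OF h, of "partial_deriv i p"]
        partial_deriv_simps sum.distrib partial_deriv_commute[of i] add.commute)
  let ?X = "\<lambda>f g. \<Sum>i\<in>UNIV. \<Sum>j\<in>UNIV. partial_deriv i (f (var j)) * partial_deriv j (g (var i))"
  have "divergence (commutator f g) =
      (\<Sum>i\<in>UNIV. partial_deriv i (f (g (var i)))) - (\<Sum>i\<in>UNIV. partial_deriv i (g (f (var i))))"
    by (simp add: divergence_def commutator_apply partial_deriv_simps sum_subtractf)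
  also have "\<dots> = (f (divergence g) + ?X f g) - (g (divergence f) + ?X g f)"
    by (simp only: pd[OF f, of _ "g _"] pd[OF g, of _ "f _"] sum.distrib divergence_def
        derivation_sum[OF f] derivation_sum[OF g])
  also have "?X g f = ?X f g"
    by (subst sum.swap) (simp add: mult.commute)
  finally show ?thesis by simp
qed

lemma partial_deriv_surj:
  fixes p :: "('n, 'k::field_char_0) mpoly"
  shows "\<exists>q. partial_deriv i q = p"
proof (induction p rule: mpoly_induct)
  case (add p q)
  then show ?case by (metis partial_deriv_add)
next
  case (single m c)
  have "of_nat (poly_mapping.lookup m i + 1) * (c / of_nat (poly_mapping.lookup m i + 1)) = c"
    by (simp del: of_nat_add of_nat_Suc)
  then have "partial_deriv i (Poly_Mapping.single (m + Poly_Mapping.single i 1)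
      (c / of_nat (poly_mapping.lookup m i + 1))) = Poly_Mapping.single m c"
    by (simp only: partial_deriv_single lookup_add lookup_single_eq add_diff_cancel_right')
  then show ?case by blast
qed

section \<open>Products under powers of a derivation\<close>

lemma derivation_funpow_0:
  assumes "\<delta> \<in> derivations" shows "(\<delta> ^^ k) 0 = 0"
  by (induction k) (simp_all add: derivation_0[OF assms])

lemma derivation_funpow_add:
  assumes "\<delta> \<in> derivations" shows "(\<delta> ^^ k) (p + q) = (\<delta> ^^ k) p + (\<delta> ^^ k) q"
  by (induction k) (simp_all add: derivation_add[OF assms])

text \<open>In the Leibniz expansion of order \<open>l + m\<close>, every other term differentiates
  \<open>p\<close> more than \<open>l\<close> times or \<open>q\<close> more than \<open>m\<close>
  times. Pascal's rule gives the surviving term by induction, without the full expansion.\<close>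

lemma derivation_funpow_mult_top:
  assumes d: "\<delta> \<in> derivations"
  shows "(\<delta> ^^ Suc l) p = 0 \<Longrightarrow> (\<delta> ^^ Suc m) q = 0 \<Longrightarrow>
    (\<delta> ^^ (l + m)) (p * q) = of_nat (l + m choose l) * ((\<delta> ^^ l) p * (\<delta> ^^ m) q)"
proof (induction "l + m" arbitrary: l m p q)
  case 0
  then show ?case by simp
next
  case (Suc s)
  have eq: "(\<delta> ^^ (l + m)) (p * q) = (\<delta> ^^ s) (\<delta> p * q) + (\<delta> ^^ s) (p * \<delta> q)"
    by (simp only: Suc(2)[symmetric] funpow_Suc_right comp_apply derivation_mult[OF d]
        derivation_funpow_add[OF d])
  have 1: "(\<delta> ^^ s) (\<delta> p * q) = of_nat (s choose l') * ((\<delta> ^^ l) p * (\<delta> ^^ m) q)" if "l = Suc l'" for l'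
    using Suc(1)[of l' m "\<delta> p" q] Suc(2-) that by (simp add: funpow_swap1)
  have 2: "(\<delta> ^^ s) (p * \<delta> q) = of_nat (s choose l) * ((\<delta> ^^ l) p * (\<delta> ^^ m) q)" if "m = Suc m'" for m'
    using Suc(1)[of l m' p "\<delta> q"] Suc(2-) that by (simp add: funpow_swap1)
  show ?case
  proof (cases l)
    case 0
    then have "\<delta> p = 0" "m = Suc s" using Suc by auto
    then show ?thesis
      unfolding eq using 2[of s] 0 by (simp add: derivation_funpow_0[OF d])
  next
    case l: (Suc l')
    show ?thesis
    proof (cases m)
      case 0
      then have "\<delta> q = 0" "s = l'" using Suc l by auto
      then show ?thesis
        unfolding eq using 1[of l'] l 0 by (simp add: derivation_funpow_0[OF d])
    next
      case (Suc m')
      have "l + m choose l = (s choose l') + (s choose l)"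
        using l Suc \<open>Suc s = l + m\<close> by (metis add_Suc add_Suc_right binomial_Suc_Suc diff_Suc_1)
      then show ?thesis
        unfolding eq 1[OF l] 2[OF Suc] by (simp add: algebra_simps)
    qed
  qed
qed

text \<open>The number \<open>l\<close> serves as the degree of \<open>p\<close> with respect to
  \<open>f\<close>.\<close>

lemma funpow_last_nonzero:
  fixes f :: "'a::zero \<Rightarrow> 'a"
  assumes "(f ^^ N) p = 0" "p \<noteq> 0"
  obtains l where "(f ^^ l) p \<noteq> 0" "(f ^^ Suc l) p = 0"
proof -
  define l where "l = (LEAST k. (f ^^ Suc k) p = 0)"
  have "N \<noteq> 0" using assms by (metis funpow_0)
  then have "(f ^^ Suc (N - 1)) p = 0" using assms(1) by (simp del: funpow.simps)
  then have "(f ^^ Suc l) p = 0"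
    unfolding l_def by (rule LeastI[where P = "\<lambda>k. (f ^^ Suc k) p = 0"])
  moreover have "(f ^^ l) p \<noteq> 0"
  proof (cases l)
    case 0
    then show ?thesis using assms by simp
  next
    case (Suc k)
    then show ?thesis using not_less_Least[of k "\<lambda>k. (f ^^ Suc k) p = 0"] by (simp add: l_def del: funpow.simps)
  qed
  ultimately show ?thesis using that by blast
qed

section \<open>Absence of zero divisors\<close>

lemma const_of_nat: "const (of_nat k) = of_nat k"
  by (simp add: const_def)

lemma of_nat_mult_eq_0_iff:
  fixes p :: "('n, 'k::field_char_0) mpoly"
  shows "of_nat k * p = 0 \<longleftrightarrow> k = 0 \<or> p = 0"
  using poly_space.scale_eq_0_iff[of "of_nat k" p] by (simp add: pscale_def const_of_nat)

lemma funpow_eq_0_mono: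
  fixes f :: "'a::zero \<Rightarrow> 'a"
  assumes "f 0 = 0" "(f ^^ k) p = 0" "k \<le> l"
  shows "(f ^^ l) p = 0"
proof -
  have "(f ^^ j) 0 = 0" for j
    by (induction j) (simp_all add: assms(1))
  moreover have "(f ^^ l) p = (f ^^ (l - k)) ((f ^^ k) p)"
    using assms(3) by (simp flip: funpow_add comp_apply[of "f ^^ _"])
  ultimately show ?thesis
    using assms(2) by simp
qed

lemma partial_deriv_locally_nilpotent:
  fixes p :: "('n::finite, 'k::field_char_0) mpoly"
  shows "\<exists>k. (partial_deriv i ^^ k) p = 0"
proof (induction p rule: mpoly_induct)
  case (add p q)
  then obtain k l where kl: "(partial_deriv i ^^ k) p = 0" "(partial_deriv i ^^ l) q = 0"
    by blast
  have "(partial_deriv i ^^ max k l) p = 0" "(partial_deriv i ^^ max k l) q = 0"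
    by (rule funpow_eq_0_mono[OF _ kl(1)] funpow_eq_0_mono[OF _ kl(2)];
        simp add: partial_deriv_simps)+
  then show ?case
    by (metis derivation_funpow_add[OF partial_deriv_derivation] add_0)
next
  case (single m c)
  have "(partial_deriv i ^^ Suc (poly_mapping.lookup m i)) (Poly_Mapping.single m c) = 0"
  proof (induction "poly_mapping.lookup m i" arbitrary: m c)
    case 0
    then show ?case by (simp add: partial_deriv_single)
  next
    case (Suc s)
    have s: "s = poly_mapping.lookup (m - Poly_Mapping.single i 1) i"
      using Suc(2) by (simp add: lookup_minus)
    show ?case
      using Suc(1)[OF s] unfolding Suc(2)[symmetric] s[symmetric] funpow_Suc_right[of "Suc s"] comp_apply
        partial_deriv_single .
  qed
  then show ?case by blast
qed

text \<open>Top-order iterated partial derivatives turn both factors into constants, while their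
  product remains 0.\<close>

lemma mpoly_no_zero_divisors:
  fixes p q :: "('n::finite, 'k::field_char_0) mpoly"
  assumes "p * q = 0" "p \<noteq> 0"
  shows "q = 0"
proof (rule ccontr)
  assume "q \<noteq> 0"
  \<comment> \<open>Induction over the set of variables already removed from both factors.\<close>
  have "\<exists>p q :: ('n, 'k) mpoly. p \<noteq> 0 \<and> q \<noteq> 0 \<and> p * q = 0 \<and>
      (\<forall>i\<in>A. partial_deriv i p = 0 \<and> partial_deriv i q = 0)" if "finite A" for A :: "'n set"
    using that
  proof induction
    case empty
    then show ?case using assms \<open>q \<noteq> 0\<close> by blast
  next
    case (insert i A)
    let ?d = "partial_deriv i :: ('n, 'k) mpoly_endo"
    obtain p q :: "('n, 'k) mpoly" where pq: "p \<noteq> 0" "q \<noteq> 0" "p * q = 0"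
        "\<And>j. j \<in> A \<Longrightarrow> partial_deriv j p = 0" "\<And>j. j \<in> A \<Longrightarrow> partial_deriv j q = 0"
      using insert.IH by blast
    obtain l where l: "(?d ^^ l) p \<noteq> 0" "(?d ^^ Suc l) p = 0"
      using partial_deriv_locally_nilpotent funpow_last_nonzero pq(1) by metis
    obtain m where m: "(?d ^^ m) q \<noteq> 0" "(?d ^^ Suc m) q = 0"
      using partial_deriv_locally_nilpotent funpow_last_nonzero pq(2) by metis
    have "of_nat (l + m choose l) * ((?d ^^ l) p * (?d ^^ m) q) = 0"
      using derivation_funpow_mult_top[OF partial_deriv_derivation l(2) m(2)]
      by (simp add: pq(3) derivation_funpow_0[OF partial_deriv_derivation])
    then have 0: "(?d ^^ l) p * (?d ^^ m) q = 0"
      by (simp add: of_nat_mult_eq_0_iff)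
    \<comment> \<open>Partial derivatives commute, so differentiating by \<open>i\<close> does not
      bring back a variable from \<open>A\<close>.\<close>
    have comm: "partial_deriv j ((?d ^^ k) r) = 0" if "partial_deriv j r = 0" for j k r
      by (induction k) (simp_all add: that partial_deriv_commute[of j] partial_deriv_simps)
    show ?case
      using l m 0 by (intro exI[of _ "(?d ^^ l) p"] exI[of _ "(?d ^^ m) q"])
        (auto intro: comm pq)
  qed
  from this[of UNIV] obtain p q :: "('n, 'k) mpoly" where pq: "p \<noteq> 0" "q \<noteq> 0" "p * q = 0"
      "p \<in> range const" "q \<in> range const"
    by (auto simp: range_const_iff)
  then obtain a where a: "p = const a" by blast
  then have "a = 0"
    using pq poly_space.scale_eq_0_iff[of a q] by (simp add: pscale_def)
  then show False
    using pq(1) a by (simp add: const_def)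
qed

section \<open>Ad-nilpotent derivations have divergence zero\<close>

text \<open>The exponent \<open>k\<close> may depend on \<open>g\<close>, so this is local
  nilpotency of the adjoint action. It refers only to the Lie structure of
  \<open>derivations\<close>, hence Lie automorphisms preserve it.\<close>

definition ad_nilpotent :: "('n::finite, 'k::field_char_0) mpoly_endo set" where
  "ad_nilpotent = {\<delta> \<in> derivations. \<forall>g\<in>derivations. \<exists>k. (commutator \<delta> ^^ k) g = 0}"

text \<open>Since \<open>\<delta>\<close> commutes with itself, the bracket with
  \<open>\<delta>\<close> acts on the field \<open>p * \<delta>\<close> through \<open>p\<close>
  alone. A nonzero value \<open>\<delta> q\<close> is then cancelled by the absence of zero
  divisors.\<close>

lemma ad_nilpotent_locally_nilpotent:
  assumes "\<delta> \<in> ad_nilpotent"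
  shows "\<exists>k. (\<delta> ^^ k) p = 0"
proof (cases "\<exists>q. \<delta> q \<noteq> 0")
  case False
  then show ?thesis by (intro exI[of _ 1]) simp
next
  case True
  then obtain q where q: "\<delta> q \<noteq> 0" by blast
  have d: "\<delta> \<in> derivations" using assms by (simp add: ad_nilpotent_def)
  have *: "(commutator \<delta> ^^ k) (\<lambda>r. p * \<delta> r) = (\<lambda>r. (\<delta> ^^ k) p * \<delta> r)" for k
    by (induction k) (simp_all add: fun_eq_iff commutator_apply derivation_mult[OF d])
  obtain k where "(commutator \<delta> ^^ k) (\<lambda>r. p * \<delta> r) = 0"
    using assms derivation_module_closed[OF d] unfolding ad_nilpotent_def by blast
  then have "(\<delta> ^^ k) p * \<delta> q = 0"
    unfolding * by (simp add: fun_eq_iff)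
  then show ?thesis
    using mpoly_no_zero_divisors[of "\<delta> q" "(\<delta> ^^ k) p"] q by (auto simp: mult.commute)
qed

section \<open>The product rule for determinants, and the volume form\<close>

lemma derivation_prod:
  assumes "\<delta> \<in> derivations" "finite S"
  shows "\<delta> (prod f S) = (\<Sum>i\<in>S. \<Prod>a\<in>S. if a = i then \<delta> (f a) else f a)"
  using assms(2)
proof induction
  case empty
  then show ?case by (simp add: derivation_1[OF assms(1)])
next
  case (insert x S)
  have 1: "(\<Prod>a\<in>S. if a = x then \<delta> (f a) else f a) = prod f S"
    using insert by (intro prod.cong) auto
  have 2: "(\<Prod>a\<in>insert x S. if a = i then \<delta> (f a) else f a) =
      f x * (\<Prod>a\<in>S. if a = i then \<delta> (f a) else f a)" if "i \<in> S" for i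
    using insert that by (subst prod.insert) auto
  show ?case
    using insert 1 2
    by (simp add: derivation_mult[OF assms(1)] sum_distrib_left)
qed

lemma derivation_of_int:
  assumes "\<delta> \<in> derivations" shows "\<delta> (of_int k) = 0"
  by (cases k rule: int_cases2)
    (simp_all add: derivation_of_nat[OF assms] derivation_minus[OF assms])

text \<open>The product rule acts on each term of the Leibniz formula, whose signs are killed by
  \<open>\<delta>\<close>. Exchanging the sums over permutations and rows collects determinants
  again.\<close>

lemma derivation_det:
  fixes M :: "('n::finite, 'k::field_char_0) mpoly ^ 'm ^ 'm"
  assumes d: "\<delta> \<in> derivations"
  shows "\<delta> (det M) = (\<Sum>i\<in>UNIV. det (\<chi> a. if a = i then \<chi> j. \<delta> (M $ a $ j) else M $ a))"
proof -
  have "\<delta> (det M) = (\<Sum>p | p permutes UNIV. of_int (sign p) *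
      (\<Sum>i\<in>UNIV. \<Prod>a\<in>UNIV. if a = i then \<delta> (M $ a $ p a) else M $ a $ p a))"
    by (simp add: det_def derivation_sum[OF d] derivation_mult[OF d] derivation_of_int[OF d]
        derivation_prod[OF d])
  also have "\<dots> = (\<Sum>p | p permutes UNIV. \<Sum>i\<in>UNIV. of_int (sign p) *
      (\<Prod>a\<in>UNIV. (\<chi> a. if a = i then \<chi> j. \<delta> (M $ a $ j) else M $ a) $ a $ p a))"
    by (auto simp: sum_distrib_left intro!: sum.cong prod.cong arg_cong2[where f = "(*)"])
  also have "\<dots> = (\<Sum>i\<in>UNIV. det (\<chi> a. if a = i then \<chi> j. \<delta> (M $ a $ j) else M $ a))"
    unfolding det_def by (rule sum.swap)
  finally show ?thesis .
qed

text \<open>In the Leibniz formula it makes no difference whether a product is modified in the factor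
  of row \<open>i\<close>, summed over \<open>i\<close>, or in that of column \<open>l\<close>, summed over \<open>l\<close>. In column form each
  summand is a combination of determinants with at most one having distinct columns.\<close>

lemma sum_det_replace_row_mult:
  fixes G A :: "'a::comm_ring_1 ^ 'm ^ 'm"
  shows "(\<Sum>i\<in>UNIV. det (\<chi> a. if a = i then (G ** A) $ a else G $ a)) = trace A * det G"
proof -
  let ?G = "transpose G"
  have "(\<Sum>i\<in>UNIV. det (\<chi> a. if a = i then (G ** A) $ a else G $ a)) =
      (\<Sum>p | p permutes UNIV. of_int (sign p) *
        (\<Sum>i\<in>UNIV. \<Prod>a\<in>UNIV. if a = i then (G ** A) $ a $ p a else G $ a $ p a))"
    unfolding det_def sum_distrib_left
    by (subst sum.swap) (auto intro!: sum.cong prod.cong arg_cong2[where f = "(*)"])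
  also have "\<dots> = (\<Sum>p | p permutes UNIV. of_int (sign p) *
        (\<Sum>l\<in>UNIV. \<Prod>a\<in>UNIV. if p a = l then (G ** A) $ a $ p a else G $ a $ p a))"
  proof (rule sum.cong[OF refl], rule arg_cong2[where f = "(*)", OF refl])
    fix p :: "'m \<Rightarrow> 'm" assume "p \<in> {p. p permutes UNIV}"
    then have p: "p permutes UNIV" by simp
    \<comment> \<open>Reindex by \<open>l = p i\<close>: as \<open>p\<close> is injective, column
      \<open>l\<close> singles out exactly row \<open>i\<close>.\<close>
    show "(\<Sum>i\<in>UNIV. \<Prod>a\<in>UNIV. if a = i then (G ** A) $ a $ p a else G $ a $ p a) =
        (\<Sum>l\<in>UNIV. \<Prod>a\<in>UNIV. if p a = l then (G ** A) $ a $ p a else G $ a $ p a)"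
      by (subst (2) sum.permute[OF p]) (simp add: permutes_inj[OF p] inj_eq)
  qed
  also have "\<dots> = (\<Sum>l\<in>UNIV. det (\<chi> a j. if j = l then (G ** A) $ a $ j else G $ a $ j))"
    unfolding det_def sum_distrib_left
    by (subst sum.swap) (auto intro!: sum.cong prod.cong arg_cong2[where f = "(*)"])
  also have "\<dots> = (\<Sum>l\<in>UNIV. A $ l $ l * det G)"
  proof (intro sum.cong refl)
    fix l
    have "det (\<chi> a j. if j = l then (G ** A) $ a $ j else G $ a $ j) =
        det (transpose (\<chi> a j. if j = l then (G ** A) $ a $ j else G $ a $ j))"
      by (simp only: det_transpose)
    \<comment> \<open>Column \<open>l\<close> of \<open>G ** A\<close> is a linear combination of
      the columns of \<open>G\<close>. Transposing turns columns into rows, and linearity in row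
      \<open>l\<close> leaves only the diagonal coefficient \<open>A $ l $ l\<close>.\<close>
    also have "transpose (\<chi> a j. if j = l then (G ** A) $ a $ j else G $ a $ j) =
        (\<chi> j. if j = l then \<Sum>k\<in>UNIV. A $ k $ l *s ?G $ k else ?G $ j)"
      by (simp add: vec_eq_iff transpose_def matrix_matrix_mult_def mult.commute)
    also have "det \<dots> = (\<Sum>k\<in>UNIV. det (\<chi> j. if j = l then A $ k $ l *s ?G $ k else ?G $ j))"
      by (rule det_linear_row_sum) simp
    also have "\<dots> = (\<Sum>k\<in>UNIV. A $ k $ l * det (\<chi> j. if j = l then ?G $ k else ?G $ j))"
      by (simp only: det_row_mul)
    also have "\<dots> = (\<Sum>k\<in>UNIV. if k = l then A $ l $ l * det G else 0)"
    proof (intro sum.cong refl)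
      fix k
      show "A $ k $ l * det (\<chi> j. if j = l then ?G $ k else ?G $ j) =
          (if k = l then A $ l $ l * det G else 0)"
      proof (cases "k = l")
        case True
        then have "(\<chi> j. if j = l then ?G $ k else ?G $ j) = ?G"
          by (simp add: vec_eq_iff)
        with True show ?thesis by simp
      next
        case False
        then have "det (\<chi> j. if j = l then ?G $ k else ?G $ j) = 0"
          by (intro det_identical_rows[of k l]) (simp_all add: row_def)
        with False show ?thesis by simp
      qed
    qed
    finally show "det (\<chi> a j. if j = l then (G ** A) $ a $ j else G $ a $ j) = A $ l $ l * det G"
      by simp
  qed
  finally show ?thesis
    by (simp add: trace_def sum_distrib_right)
qed

text \<open>This is the standard volume form evaluated on the fields \<open>g i\<close>.\<close>

definition coeff_det :: "('n::finite \<Rightarrow> ('n, 'k::field_char_0) mpoly_endo) \<Rightarrow> ('n, 'k) mpoly" where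
  "coeff_det g = det (\<chi> i j. g i (var j))"

lemma coeff_det_eq_0:
  assumes "g i = 0" shows "coeff_det g = 0"
proof -
  have "prod (\<lambda>a. g a (var (p a))) UNIV = 0" for p
    using assms by (intro prod_zero bexI[of _ i]) auto
  then show ?thesis
    by (simp add: coeff_det_def det_def)
qed

lemma coeff_det_partial_deriv: "coeff_det partial_deriv = 1"
proof -
  have "(\<chi> i j. partial_deriv i (var j)) = (mat 1 :: ('a, 'b) mpoly ^ 'a ^ 'a)"
    by (simp add: vec_eq_iff mat_def partial_deriv_var)
  then show ?thesis by (simp add: coeff_det_def)
qed

text \<open>This is the Lie derivative of the volume form along \<open>\<delta>\<close>, which is
  the form multiplied by the divergence of \<open>\<delta>\<close>.\<close>

lemma coeff_det_commutator:
  assumes d: "\<delta> \<in> derivations" and g: "\<And>i. g i \<in> derivations"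
  shows "\<delta> (coeff_det g) - divergence \<delta> * coeff_det g =
    (\<Sum>i\<in>UNIV. coeff_det (g(i := commutator \<delta> (g i))))"
proof -
  define G where "G = (\<chi> i j. g i (var j))"
  define A where "A = (\<chi> k j. partial_deriv k (\<delta> (var j)))"
  \<comment> \<open>Trade \<open>\<delta> \<circ> g a\<close> for
    \<open>g a \<circ> \<delta>\<close> plus the bracket. By the chain rule,
    \<open>g a \<circ> \<delta>\<close> gives row \<open>a\<close> of \<open>G\<close> times the
    Jacobian matrix \<open>A\<close> of \<open>\<delta>\<close>, whose trace is the
    divergence.\<close>
  have row: "(\<chi> j. \<delta> (G $ a $ j)) = (\<chi> j. commutator \<delta> (g a) (var j)) + (G ** A) $ a" for a
    by (simp add: vec_eq_iff commutator_apply G_def A_def matrix_matrix_mult_def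
        derivation_apply[OF g, of _ "\<delta> _"])
  have "\<delta> (coeff_det g) = (\<Sum>i\<in>UNIV. det (\<chi> a. if a = i then \<chi> j. \<delta> (G $ a $ j) else G $ a))"
    unfolding coeff_det_def G_def[symmetric] by (rule derivation_det[OF d])
  also have "\<dots> =
      (\<Sum>i\<in>UNIV. det (\<chi> a. if a = i then \<chi> j. commutator \<delta> (g a) (var j) else G $ a)) +
      (\<Sum>i\<in>UNIV. det (\<chi> a. if a = i then (G ** A) $ a else G $ a))"
    unfolding row det_row_add by (rule sum.distrib)
  also have "(\<Sum>i\<in>UNIV. det (\<chi> a. if a = i then (G ** A) $ a else G $ a)) =
      divergence \<delta> * coeff_det g"
    unfolding sum_det_replace_row_mult
    by (simp add: trace_def A_def divergence_def coeff_det_def G_def)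
  also have "(\<lambda>i. det (\<chi> a. if a = i then \<chi> j. commutator \<delta> (g a) (var j) else G $ a)) =
      (\<lambda>i. coeff_det (g(i := commutator \<delta> (g i))))"
    by (auto simp: coeff_det_def G_def vec_eq_iff intro!: arg_cong[where f = det])
  finally show ?thesis by simp
qed

text \<open>By \<open>coeff_det_commutator\<close>, each application of the operator distributes one
  bracket with \<open>\<delta>\<close> over the fields. After as many steps as the sum of the
  \<open>k i\<close>, every resulting term has used up the bound of some field.\<close>

lemma coeff_det_nilpotent:
  assumes d: "\<delta> \<in> derivations"
  shows "(\<And>i. g i \<in> derivations) \<Longrightarrow> (\<And>i. (commutator \<delta> ^^ k i) (g i) = 0) \<Longrightarrow>
    ((\<lambda>p. \<delta> p - divergence \<delta> * p) ^^ (\<Sum>i\<in>UNIV. k i)) (coeff_det g) = 0"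
proof (induction "\<Sum>i\<in>UNIV. k i" arbitrary: g k)
  case 0
  \<comment> \<open>All bounds are 0, hence all fields vanish; the determinant is 0 because the
    index type is nonempty.\<close>
  then have "g i = 0" for i by (metis UNIV_I finite_class.finite_UNIV funpow_0 sum_eq_0_iff)
  then have "coeff_det g = 0" by (rule coeff_det_eq_0)
  then show ?case using 0(1) by simp
next
  case (Suc s)
  let ?E = "\<lambda>p. \<delta> p - divergence \<delta> * p"
  have E_add: "(?E ^^ s) (\<Sum>i\<in>A. f i) = (\<Sum>i\<in>A. (?E ^^ s) (f i))" for A :: "'a set" and f
    by (induction s)
      (simp_all add: derivation_sum[OF d] sum_subtractf sum_distrib_left)
  have E0: "(?E ^^ s) 0 = 0"
    using E_add[of "\<lambda>_. 0" "{}"] by simp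
  have "(?E ^^ s) (coeff_det (g(i := commutator \<delta> (g i)))) = 0" for i
  proof (cases "k i")
    case 0
    then have "g i = 0" using Suc.prems(2)[of i] by simp
    then have "commutator \<delta> (g i) = 0"
      by (simp add: fun_eq_iff commutator_apply derivation_0[OF d])
    then show ?thesis
      by (simp add: coeff_det_eq_0[of _ i] E0)
  next
    case (Suc m)
    have s: "s = (\<Sum>j\<in>UNIV. (k(i := m)) j)"
      using \<open>Suc s = _\<close> Suc by (simp add: sum.remove[of UNIV i])
    show ?thesis
      unfolding s
    proof (rule Suc.hyps(1)[OF s])
      show "(g(i := commutator \<delta> (g i))) j \<in> derivations" for j
        by (simp add: Suc.prems derivation_commutator_closed d)
      show "(commutator \<delta> ^^ (k(i := m)) j) ((g(i := commutator \<delta> (g i))) j) = 0" for j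
        using Suc.prems(2)[of j] Suc by (auto simp: funpow_swap1)
    qed
  qed
  then show ?case
    by (simp add: Suc.hyps(2)[symmetric] funpow_Suc_right coeff_det_commutator[OF d Suc.prems(1)]
        E_add del: funpow.simps)
qed

text \<open>Adjoint nilpotency of \<open>\<delta>\<close> makes \<open>\<delta> - divergence \<delta>\<close> nilpotent on the determinant 1 of
  the coordinate fields. Hence some \<open>u \<noteq> 0\<close> satisfies \<open>\<delta> u = divergence \<delta> * u\<close>, which is
  impossible for degree reasons unless the divergence vanishes.\<close>

lemma divergence_ad_nilpotent:
  assumes "\<delta> \<in> ad_nilpotent"
  shows "divergence \<delta> = 0"
proof (rule ccontr)
  assume nz: "divergence \<delta> \<noteq> 0"
  have d: "\<delta> \<in> derivations" using assms by (simp add: ad_nilpotent_def)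
  let ?E = "\<lambda>p. \<delta> p - divergence \<delta> * p"
  have "\<exists>k. (commutator \<delta> ^^ k) (partial_deriv i) = 0" for i
    using assms partial_deriv_derivation unfolding ad_nilpotent_def by blast
  then obtain k where "\<And>i. (commutator \<delta> ^^ k i) (partial_deriv i) = 0" by metis
  then have "(?E ^^ (\<Sum>i\<in>UNIV. k i)) 1 = 0"
    using coeff_det_nilpotent[OF d, of partial_deriv k]
    by (simp add: partial_deriv_derivation coeff_det_partial_deriv)
  then obtain N where N: "(?E ^^ N) 1 \<noteq> 0" "(?E ^^ Suc N) 1 = 0"
    by (rule funpow_last_nonzero) simp
  define u where "u = (?E ^^ N) 1"
  have u: "u \<noteq> 0" "\<delta> u = divergence \<delta> * u"
    using N by (simp_all add: u_def)
  obtain l where l: "(\<delta> ^^ l) (divergence \<delta>) \<noteq> 0" "(\<delta> ^^ Suc l) (divergence \<delta>) = 0"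
    using ad_nilpotent_locally_nilpotent[OF assms] funpow_last_nonzero nz by metis
  obtain m where m: "(\<delta> ^^ m) u \<noteq> 0" "(\<delta> ^^ Suc m) u = 0"
    using ad_nilpotent_locally_nilpotent[OF assms] funpow_last_nonzero u(1) by metis
  \<comment> \<open>Replacing \<open>divergence \<delta> * u\<close> by \<open>\<delta> u\<close>
    gives a power of \<open>\<delta>\<close> beyond \<open>m\<close> on \<open>u\<close>, so the
    value is 0. The top-order formula makes it a positive multiple of a product of two nonzero
    polynomials.\<close>
  have "(\<delta> ^^ (l + m)) (divergence \<delta> * u) = (\<delta> ^^ (l + Suc m)) u"
    by (simp add: u(2) funpow_swap1 flip: u(2))
  also have "\<dots> = 0"
    by (rule funpow_eq_0_mono[OF derivation_0[OF d] m(2)]) simp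
  finally have "(\<delta> ^^ l) (divergence \<delta>) * (\<delta> ^^ m) u = 0"
    using derivation_funpow_mult_top[OF d l(2) m(2)] by (simp add: of_nat_mult_eq_0_iff)
  then show False
    using mpoly_no_zero_divisors l(1) m(1) by blast
qed

section \<open>Generation of the divergence-free derivations\<close>

lemma commutator_funpow_Suc_apply:
  "(commutator f ^^ Suc k) g p = f ((commutator f ^^ k) g p) - (commutator f ^^ k) g (f p)"
  by (simp only: funpow.simps(2) comp_apply) (rule commutator_apply)

text \<open>As \<open>c\<close> does not involve the variable \<open>i\<close>, powers of the field
  are \<open>c ^ k\<close> times powers of \<open>partial_deriv i\<close>, so the field is locally
  nilpotent on polynomials. For the iterated brackets it suffices to look at the finitely many
  variables.\<close>

lemma mult_partial_deriv_ad_nilpotent: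
  assumes "partial_deriv i c = 0"
  shows "(\<lambda>p. c * partial_deriv i p) \<in> ad_nilpotent"
proof -
  define \<delta> where "\<delta> = (\<lambda>p. c * partial_deriv i p)"
  have d: "\<delta> \<in> derivations"
    unfolding \<delta>_def by (rule mult_partial_deriv_derivation)
  have c: "\<delta> c = 0"
    by (simp add: \<delta>_def assms)
  have pow: "(\<delta> ^^ k) p = c ^ k * (partial_deriv i ^^ k) p" for k p
  proof (induction k)
    case (Suc k)
    have "partial_deriv i (c ^ k) = 0"
      by (induction k) (simp_all add: partial_deriv_simps assms)
    with Suc show ?case
      by (simp add: \<delta>_def partial_deriv_mult mult.assoc)
  qed simp
  have nil: "\<exists>k. (\<delta> ^^ k) p = 0" for p
    using partial_deriv_locally_nilpotent[of i p] by (metis pow mult_zero_right)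
  have "\<exists>k. (commutator \<delta> ^^ k) g = 0" if g: "g \<in> derivations" for g
  proof -
    let ?h = "\<lambda>k. (commutator \<delta> ^^ k) g"
    have h: "?h k \<in> derivations" for k
      by (induction k) (simp_all add: g derivation_commutator_closed d)
    \<comment> \<open>On the kernel of \<open>\<delta>\<close> the second term of each bracket drops
      out.\<close>
    have kill: "?h k p = (\<delta> ^^ k) (g p)" if "\<delta> p = 0" for k p
      by (induction k)
        (simp_all add: commutator_funpow_Suc_apply that derivation_0[OF h] del: funpow.simps(2),
          simp_all)
    have ex: "\<exists>k. \<forall>l\<ge>k. ?h l (var j) = 0" for j
    proof (cases "j = i")
      case False
      then have "\<delta> (var j) = 0" by (simp add: \<delta>_def partial_deriv_var)
      moreover obtain k where "(\<delta> ^^ k) (g (var j)) = 0" using nil by blast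
      ultimately show ?thesis
        using funpow_eq_0_mono[where f = \<delta>, OF derivation_0[OF d]] by (metis kill)
    next
      case True
      then have ci: "\<delta> (var j) = c" by (simp add: \<delta>_def partial_deriv_var)
      obtain k where k: "(\<delta> ^^ k) (g c) = 0" using nil by blast
      \<comment> \<open>The variable is mapped to \<open>c\<close>, which lies in the kernel of
        \<open>\<delta>\<close>. Once the iterated brackets vanish on \<open>c\<close>, each further
        bracket just applies \<open>\<delta>\<close> to their value at the variable.\<close>
      have shift: "?h (k + l) (var j) = (\<delta> ^^ l) (?h k (var j))" for l
      proof (induction l)
        case (Suc l)
        have "(\<delta> ^^ (k + l)) (g c) = 0"
          by (rule funpow_eq_0_mono[where f = \<delta>, OF derivation_0[OF d] k]) simp
        then have "?h (k + l) c = 0" using kill[OF c] by simp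
        moreover have "?h (k + Suc l) (var j) = \<delta> (?h (k + l) (var j)) - ?h (k + l) c"
          by (simp only: add_Suc_right commutator_funpow_Suc_apply ci)
        ultimately show ?case
          using Suc by (simp only: diff_zero funpow.simps(2) comp_apply)
      qed simp
      obtain m where m: "(\<delta> ^^ m) (?h k (var j)) = 0" using nil by blast
      have "?h l (var j) = 0" if "k + m \<le> l" for l
      proof -
        have "(\<delta> ^^ (l - k)) (?h k (var j)) = 0"
          by (rule funpow_eq_0_mono[where f = \<delta>, OF derivation_0[OF d] m]) (use that in simp)
        then show ?thesis using shift[of "l - k"] that by simp
      qed
      then show ?thesis by blast
    qed
    then obtain K where K: "\<And>j l. l \<ge> K j \<Longrightarrow> ?h l (var j) = 0" by metis
    have "?h (Max (range K)) = 0"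
      by (rule derivation_eqI[OF h derivation_0_closed]) (simp add: K)
    then show ?thesis by blast
  qed
  with d show ?thesis
    unfolding ad_nilpotent_def \<delta>_def by blast
qed

text \<open>The right-hand side is, up to the choice of sign, the Hamiltonian field of
  \<open>u * v\<close> in the plane of \<open>i\<close> and \<open>j\<close>.\<close>

lemma commutator_mult_partial_deriv:
  fixes u v :: "('n::finite, 'k::field_char_0) mpoly"
  assumes "partial_deriv i v = 0" "partial_deriv j u = 0"
  shows "commutator (\<lambda>p. v * partial_deriv i p) (\<lambda>p. u * partial_deriv j p) =
    (\<lambda>p. partial_deriv i (u * v) * partial_deriv j p - partial_deriv j (u * v) * partial_deriv i p)"
  by (rule ext)
    (simp add: commutator_apply partial_deriv_mult assms partial_deriv_commute[of j i] algebra_simps)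

text \<open>The factor \<open>v\<close> takes the power of the variable \<open>j\<close>, and
  \<open>u\<close> takes everything else with the coefficient. This is the form required by
  \<open>commutator_mult_partial_deriv\<close>.\<close>

lemma single_split_variable:
  fixes m :: "'n::finite \<Rightarrow>\<^sub>0 nat"
  assumes "i \<noteq> j"
  obtains u v :: "('n, 'k::field_char_0) mpoly"
  where "Poly_Mapping.single m c = u * v" "partial_deriv i v = 0" "partial_deriv j u = 0"
proof
  let ?s = "Poly_Mapping.single j (poly_mapping.lookup m j)"
  have "m = (m - ?s) + ?s"
    by (rule poly_mapping_eqI) (auto simp: lookup_add lookup_minus lookup_single when_def)
  then show "Poly_Mapping.single m c = Poly_Mapping.single (m - ?s) c * Poly_Mapping.single ?s 1"
    by (simp add: mult_single)
  show "partial_deriv i (Poly_Mapping.single ?s (1::'k)) = 0"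
    using assms by (simp add: partial_deriv_single lookup_single)
  show "partial_deriv j (Poly_Mapping.single (m - ?s) c) = 0"
    by (simp add: partial_deriv_single lookup_minus)
qed

lemma sum_fun_apply: "(\<Sum>i\<in>A. F i) x = (\<Sum>i\<in>A. F i x)"
  by (induction A rule: infinite_finite_induct) simp_all

text \<open>After subtracting Hamiltonian fields in the planes of \<open>z\<close> and \<open>i \<noteq> z\<close>, only a multiple
  \<open>c * partial_deriv z\<close> remains, and then \<open>c\<close> does not involve \<open>z\<close>. The field of a monomial
  Hamiltonian is a commutator of two ad-nilpotent derivations.\<close>

lemma divergence_free_induct [consumes 2, case_names add nilpotent commutator]:
  fixes f :: "('n::finite, 'k::field_char_0) mpoly_endo"
  assumes f: "f \<in> derivations" "divergence f = 0"
    and add: "\<And>f g. f \<in> derivations \<Longrightarrow> g \<in> derivations \<Longrightarrow> P f \<Longrightarrow> P g \<Longrightarrow> P (f + g)"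
    and nil: "\<And>f. f \<in> ad_nilpotent \<Longrightarrow> P f"
    and comm: "\<And>f g. f \<in> ad_nilpotent \<Longrightarrow> g \<in> ad_nilpotent \<Longrightarrow> P (commutator f g)"
  shows "P f"
proof -
  obtain z :: 'n where True by blast
  define H :: "'n \<Rightarrow> ('n, 'k) mpoly \<Rightarrow> ('n, 'k) mpoly_endo" where
    "H = (\<lambda>i h p. partial_deriv z h * partial_deriv i p - partial_deriv i h * partial_deriv z p)"
  have H_der: "H i h \<in> derivations" for i h
    using derivation_diff[OF mult_partial_deriv_derivation mult_partial_deriv_derivation,
        of "partial_deriv z h" i "partial_deriv i h" z]
    by (simp add: H_def fun_diff_def)
  have H_P: "P (H i h)" if iz: "i \<noteq> z" for i h
  proof (induction h rule: mpoly_induct)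
    case (add h h')
    have "H i (h + h') = H i h + H i h'"
      by (simp add: H_def fun_eq_iff partial_deriv_add algebra_simps)
    then show ?case by (simp only:) (intro assms(3) H_der add)
  next
    case (single m c)
    obtain u v where uv: "Poly_Mapping.single m c = u * v" "partial_deriv z v = 0"
        "partial_deriv i u = 0"
      by (rule single_split_variable[OF iz[symmetric]])
    show ?case
      unfolding H_def uv(1) commutator_mult_partial_deriv[OF uv(2,3), symmetric]
      by (intro comm mult_partial_deriv_ad_nilpotent uv)
  qed
  \<comment> \<open>Antiderivatives in \<open>z\<close> make \<open>H i (h i)\<close> agree with
    \<open>f\<close> in the coefficient of \<open>partial_deriv i\<close> for
    \<open>i \<noteq> z\<close>.\<close>
  have "\<forall>i. \<exists>q. partial_deriv z q = f (var i)"
    by (intro allI partial_deriv_surj)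
  then obtain h where h: "\<And>i. partial_deriv z (h i) = f (var i)"
    by metis
  have sum: "(\<Sum>i\<in>A. H i (h i)) \<in> derivations \<and> P (\<Sum>i\<in>A. H i (h i))" if "z \<notin> A" for A
    using finite[of A] that
  proof induction
    case empty
    have "(0 :: ('n, 'k) mpoly_endo) \<in> ad_nilpotent"
      using mult_partial_deriv_ad_nilpotent[of z 0] by (simp add: partial_deriv_simps zero_fun_def)
    then show ?case
      using derivation_0_closed nil by (simp only: sum.empty)
  next
    case (insert i A)
    have eq: "(\<Sum>i\<in>insert i A. H i (h i)) = H i (h i) + (\<Sum>i\<in>A. H i (h i))"
      using insert by (intro sum.insert) auto
    show ?case
      unfolding eq using insert by (intro conjI add H_P H_der derivation_plus_closed) auto
  qed
  \<comment> \<open>The fields \<open>H i (h i)\<close> also contribute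
    \<open>- partial_deriv i (h i)\<close> to the coefficient of \<open>partial_deriv z\<close>,
    which \<open>c\<close> compensates.\<close>
  define c where "c = f (var z) + (\<Sum>i\<in>-{z}. partial_deriv i (h i))"
  have "partial_deriv z c = partial_deriv z (f (var z)) + (\<Sum>i\<in>-{z}. partial_deriv i (f (var i)))"
    by (simp add: c_def partial_deriv_simps partial_deriv_commute[of z] h)
  also have "\<dots> = divergence f"
    by (simp add: divergence_def Compl_eq_Diff_UNIV sum.remove[of UNIV z])
  finally have c: "partial_deriv z c = 0"
    by (simp add: f)
  have var: "(\<Sum>i\<in>-{z}. H i (h i)) (var j) =
      (if j = z then - (\<Sum>i\<in>-{z}. partial_deriv i (h i)) else f (var j))" for j
  proof -
    have "H i (h i) (var j) = (if i = j then f (var j) else 0) -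
        (if j = z then partial_deriv i (h i) else 0)" for i
      by (simp add: H_def partial_deriv_var h)
    then have "(\<Sum>i\<in>-{z}. H i (h i)) (var j) = (\<Sum>i\<in>-{z}. if i = j then f (var j) else 0) -
        (\<Sum>i\<in>-{z}. if j = z then partial_deriv i (h i) else 0)"
      by (simp add: sum_fun_apply sum_subtractf)
    then show ?thesis by simp
  qed
  have "f = (\<Sum>i\<in>-{z}. H i (h i)) + (\<lambda>p. c * partial_deriv z p)" (is "f = ?S + ?C")
  proof (rule derivation_eqI[OF f(1)])
    show "?S + ?C \<in> derivations"
      using sum[of "- {z}"] by (intro derivation_plus_closed mult_partial_deriv_derivation) simp
    show "f (var j) = (?S + ?C) (var j)" for j
      unfolding plus_fun_apply var by (simp add: partial_deriv_var c_def)
  qed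
  moreover have "P (?S + ?C)"
    using sum[of "- {z}"]
    by (intro add[OF _ mult_partial_deriv_derivation _ nil[OF mult_partial_deriv_ad_nilpotent[OF c]]])
      simp_all
  ultimately show ?thesis by (rule ssubst[of f _ P])
qed

section \<open>Invariance\<close>

lemma const_div_derivations_iff:
  "f \<in> const_div_derivations \<longleftrightarrow> f \<in> derivations \<and> divergence f \<in> range const"
  by (auto simp: const_div_derivations_def)

lemma divergence_free_const_div:
  "f \<in> derivations \<Longrightarrow> divergence f = 0 \<Longrightarrow> f \<in> const_div_derivations"
  by (simp add: const_div_derivations_iff range_const_iff partial_deriv_simps)

lemma divergence_commutator_const_div:
  assumes "f \<in> const_div_derivations" "g \<in> const_div_derivations"
  shows "divergence (commutator f g) = 0"
proof -
  have f: "f \<in> derivations" and g: "g \<in> derivations"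
    using assms by (auto simp: const_div_derivations_iff)
  obtain a b where "divergence f = const a" "divergence g = const b"
    using assms by (auto simp: const_div_derivations_iff)
  then show ?thesis
    by (simp add: divergence_commutator[OF f g] derivation_const[OF f] derivation_const[OF g])
qed

lemma lie_subalgebra_const_div: "lie_subalgebra const_div_derivations derivations"
  unfolding lie_subalgebra_def endo_space.subspace_def
proof (intro conjI ballI allI)
  show "const_div_derivations \<subseteq> derivations"
    by (auto simp: const_div_derivations_iff)
  show "0 \<in> const_div_derivations"
    by (intro divergence_free_const_div derivation_0_closed divergence_0)
  show "f + g \<in> const_div_derivations"
    if "f \<in> const_div_derivations" "g \<in> const_div_derivations" for f g :: "('a, 'b) mpoly_endo"
    using that by (simp add: const_div_derivations_iff range_const_iff divergence_add
        partial_deriv_add derivation_plus_closed)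
  show "escale c f \<in> const_div_derivations"
    if "f \<in> const_div_derivations" for c and f :: "('a, 'b) mpoly_endo"
    using that by (simp add: const_div_derivations_iff range_const_iff divergence_escale
        partial_deriv_pscale derivation_escale_closed)
  show "commutator f g \<in> const_div_derivations"
    if "f \<in> const_div_derivations" "g \<in> const_div_derivations" for f g :: "('a, 'b) mpoly_endo"
    using that by (intro divergence_free_const_div divergence_commutator_const_div[OF that])
      (simp add: const_div_derivations_iff derivation_commutator_closed)
qed

lemma lie_automorphisms_inv:
  assumes "\<phi> \<in> lie_automorphisms D" "module.subspace escale D"
    and "\<And>f g. f \<in> D \<Longrightarrow> g \<in> D \<Longrightarrow> commutator f g \<in> D"
  shows "inv_into D \<phi> \<in> lie_automorphisms D"
proof -
  have b: "bij_betw \<phi> D D" and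
    hom: "\<And>f g. f \<in> D \<Longrightarrow> g \<in> D \<Longrightarrow> \<phi> (f + g) = \<phi> f + \<phi> g"
      "\<And>c f. f \<in> D \<Longrightarrow> \<phi> (escale c f) = escale c (\<phi> f)"
      "\<And>f g. f \<in> D \<Longrightarrow> g \<in> D \<Longrightarrow> \<phi> (commutator f g) = commutator (\<phi> f) (\<phi> g)"
    using assms(1) unfolding lie_automorphisms_def by blast+
  let ?\<psi> = "inv_into D \<phi>"
  have bi: "bij_betw ?\<psi> D D" by (rule bij_betw_inv_into[OF b])
  have mem: "?\<psi> f \<in> D" "\<phi> (?\<psi> f) = f" if "f \<in> D" for f
    using that bi b bij_betw_inv_into_right[OF b] by (auto simp: bij_betw_def)
  have eq: "?\<psi> f = h" if "h \<in> D" "\<phi> h = f" for f h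
    using that bij_betw_inv_into_left[OF b] by blast
  show ?thesis
    unfolding lie_automorphisms_def
    by (auto simp: bi mem hom assms(3) endo_space.subspace_add[OF assms(2)]
        endo_space.subspace_scale[OF assms(2)] intro!: eq)
qed

section \<open>Transport along an automorphism of the Lie algebra\<close>

context
  fixes \<phi> :: "('n::finite, 'k::field_char_0) mpoly_endo \<Rightarrow> ('n, 'k) mpoly_endo"
  assumes aut: "\<phi> \<in> lie_automorphisms derivations"
begin

lemma lie_aut_bij: "bij_betw \<phi> derivations derivations"
  using aut unfolding lie_automorphisms_def by blast

lemma lie_aut_closed: "f \<in> derivations \<Longrightarrow> \<phi> f \<in> derivations"
  using lie_aut_bij by (rule bij_betwE[THEN bspec])

lemma lie_aut_surj: "f \<in> derivations \<Longrightarrow> \<exists>g\<in>derivations. \<phi> g = f"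
  using lie_aut_bij by (metis bij_betw_imp_surj_on imageE)

lemma lie_aut_add: "f \<in> derivations \<Longrightarrow> g \<in> derivations \<Longrightarrow> \<phi> (f + g) = \<phi> f + \<phi> g"
  using aut unfolding lie_automorphisms_def by blast

lemma lie_aut_commutator:
  "f \<in> derivations \<Longrightarrow> g \<in> derivations \<Longrightarrow> \<phi> (commutator f g) = commutator (\<phi> f) (\<phi> g)"
  using aut unfolding lie_automorphisms_def by blast

text \<open>An automorphism intertwines the iterated brackets, and surjectivity writes every test
  field as an image.\<close>

lemma lie_aut_ad_nilpotent:
  assumes "\<delta> \<in> ad_nilpotent" shows "\<phi> \<delta> \<in> ad_nilpotent"
proof -
  have d: "\<delta> \<in> derivations" using assms by (simp add: ad_nilpotent_def)
  have zero: "\<phi> 0 = 0"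
    using lie_aut_add[OF derivation_0_closed derivation_0_closed] by simp
  have pow: "(commutator \<delta> ^^ k) g \<in> derivations \<and>
      (commutator (\<phi> \<delta>) ^^ k) (\<phi> g) = \<phi> ((commutator \<delta> ^^ k) g)" if "g \<in> derivations" for k g
    by (induction k) (simp_all add: that d derivation_commutator_closed lie_aut_commutator)
  show ?thesis
    unfolding ad_nilpotent_def
  proof (intro CollectI conjI ballI)
    show "\<phi> \<delta> \<in> derivations" by (rule lie_aut_closed[OF d])
    fix h :: "('n, 'k) mpoly_endo" assume "h \<in> derivations"
    then obtain g where g: "g \<in> derivations" "\<phi> g = h" using lie_aut_surj by blast
    obtain k where "(commutator \<delta> ^^ k) g = 0"
      using assms g(1) unfolding ad_nilpotent_def by blast
    then show "\<exists>k. (commutator (\<phi> \<delta>) ^^ k) h = 0"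
      using pow[OF g(1), of k] g(2) zero by auto
  qed
qed

lemma lie_aut_divergence_free:
  assumes "f \<in> derivations" "divergence f = 0"
  shows "divergence (\<phi> f) = 0"
  using assms
proof (induction rule: divergence_free_induct)
  case (add f g)
  then show ?case by (simp only: lie_aut_add divergence_add add_0_left)
next
  case (nilpotent f)
  then show ?case by (intro divergence_ad_nilpotent lie_aut_ad_nilpotent)
next
  case (commutator f g)
  then have "f \<in> derivations" "g \<in> derivations" by (simp_all add: ad_nilpotent_def)
  then show ?case
    using commutator
    by (simp add: lie_aut_commutator divergence_commutator lie_aut_closed
        derivation_0[OF lie_aut_closed] divergence_ad_nilpotent lie_aut_ad_nilpotent)
qed

end

text \<open>The normalizer argument in concrete form: the bracket of \<open>f\<close> with the
  preimage \<open>h\<close> of \<open>partial_deriv i\<close> is divergence-free, and so is its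
  image. The divergence of that image is, up to sign, the derivative in \<open>i\<close> of
  \<open>divergence (\<phi> f)\<close>.\<close>

lemma lie_aut_const_div:
  assumes aut: "\<phi> \<in> lie_automorphisms derivations" and f: "f \<in> const_div_derivations"
  shows "\<phi> f \<in> const_div_derivations"
proof -
  let ?\<psi> = "inv_into derivations \<phi>"
  have inv: "?\<psi> \<in> lie_automorphisms derivations"
    by (rule lie_automorphisms_inv[OF aut derivations_lie(1) derivation_commutator_closed])
  have fd: "f \<in> derivations" using f by (simp add: const_div_derivations_iff)
  have "partial_deriv i (divergence (\<phi> f)) = 0" for i
  proof -
    define h where "h = ?\<psi> (partial_deriv i)"
    have h: "h \<in> derivations" "divergence h = 0"
      unfolding h_def by (intro lie_aut_closed[OF inv] lie_aut_divergence_free[OF inv]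
          partial_deriv_derivation divergence_partial_deriv)+
    have "\<phi> h = partial_deriv i"
      using lie_aut_surj[OF aut partial_deriv_derivation[of i]] unfolding h_def
      by (metis f_inv_into_f imageI)
    moreover have "divergence (\<phi> (commutator f h)) = 0"
      by (intro lie_aut_divergence_free[OF aut] derivation_commutator_closed fd h
          divergence_commutator_const_div f divergence_free_const_div)
    ultimately show ?thesis
      by (simp add: lie_aut_commutator[OF aut] fd h divergence_commutator lie_aut_closed[OF aut]
          partial_deriv_derivation divergence_partial_deriv
          derivation_0[OF lie_aut_closed[OF aut fd]])
  qed
  then show ?thesis
    by (simp add: const_div_derivations_iff range_const_iff lie_aut_closed[OF aut] fd)
qed

lemma lie_aut_image_const_div:
  assumes aut: "\<phi> \<in> lie_automorphisms derivations"
  shows "\<phi> ` const_div_derivations = const_div_derivations"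
proof
  show "\<phi> ` const_div_derivations \<subseteq> const_div_derivations"
    using lie_aut_const_div[OF aut] by blast
  show "const_div_derivations \<subseteq> \<phi> ` const_div_derivations"
  proof
    fix f :: "('a, 'b) mpoly_endo" assume f: "f \<in> const_div_derivations"
    have "inv_into derivations \<phi> \<in> lie_automorphisms derivations"
      by (rule lie_automorphisms_inv[OF aut derivations_lie(1) derivation_commutator_closed])
    from lie_aut_const_div[OF this f]
    have "inv_into derivations \<phi> f \<in> const_div_derivations" .
    moreover have "\<phi> (inv_into derivations \<phi> f) = f"
      using lie_aut_surj[OF aut] f by (metis const_div_derivations_iff f_inv_into_f imageI)
    ultimately show "f \<in> \<phi> ` const_div_derivations" by (metis imageI)
  qed
qed

section \<open>Conjugation by polynomial automorphisms\<close>

lemma poly_automorphisms_inv: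
  assumes "\<sigma> \<in> poly_automorphisms" shows "inv \<sigma> \<in> poly_automorphisms"
proof -
  have b: "bij \<sigma>" and
    hom: "\<And>p q. \<sigma> (p + q) = \<sigma> p + \<sigma> q" "\<And>c p. \<sigma> (pscale c p) = pscale c (\<sigma> p)"
      "\<sigma> 1 = 1" "\<And>p q. \<sigma> (p * q) = \<sigma> p * \<sigma> q"
    using assms unfolding poly_automorphisms_def poly_linear_iff by blast+
  have eq: "inv \<sigma> p = q" if "\<sigma> q = p" for p q
    using that b by (metis bij_inv_eq_iff)
  have "\<sigma> (inv \<sigma> p) = p" for p
    using b by (metis bij_inv_eq_iff)
  then show ?thesis
    using bij_imp_bij_inv[OF b]
    by (auto simp: poly_automorphisms_def poly_linear_iff hom intro!: eq)
qed

lemma conj_action_derivation: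
  assumes "\<sigma> \<in> poly_automorphisms" "\<delta> \<in> derivations"
  shows "conj_action \<sigma> \<delta> \<in> derivations"
proof -
  have b: "bij \<sigma>"
    using assms(1) by (simp add: poly_automorphisms_def)
  have hom: "\<tau> (p + q) = \<tau> p + \<tau> q" "\<tau> (pscale c p) = pscale c (\<tau> p)" "\<tau> (p * q) = \<tau> p * \<tau> q"
    if "\<tau> \<in> poly_automorphisms" for \<tau> :: "('a, 'b) mpoly_endo" and c p q
    using that by (auto simp: poly_automorphisms_def poly_linear_iff)
  note hom = hom[OF assms(1)] hom[OF poly_automorphisms_inv[OF assms(1)]]
  have inv: "\<sigma> (inv \<sigma> p) = p" for p
    using b by (metis bij_inv_eq_iff)
  show ?thesis
    by (simp add: derivations_def poly_linear_iff conj_action_def hom inv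
        derivation_add[OF assms(2)] derivation_pscale[OF assms(2)] derivation_mult[OF assms(2)])
qed

text \<open>This makes invariance under polynomial automorphisms an instance of
  \<open>lie_aut_image_const_div\<close>.\<close>

lemma conj_action_lie_automorphism:
  assumes \<sigma>: "\<sigma> \<in> poly_automorphisms"
  shows "conj_action \<sigma> \<in> lie_automorphisms derivations"
proof -
  have b: "bij \<sigma>" and
    hom: "\<And>p q. \<sigma> (p + q) = \<sigma> p + \<sigma> q" "\<And>c p. \<sigma> (pscale c p) = pscale c (\<sigma> p)"
    using assms unfolding poly_automorphisms_def poly_linear_iff by blast+
  have inv: "\<sigma> (inv \<sigma> p) = p" "inv \<sigma> (\<sigma> p) = p" for p
    using b by (metis bij_inv_eq_iff)+
  have minus: "\<sigma> (p - q) = \<sigma> p - \<sigma> q" for p q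
    using hom(1)[of "p - q" q] by simp
  have "conj_action (inv \<sigma>) (conj_action \<sigma> \<delta>) = \<delta>"
    "conj_action \<sigma> (conj_action (inv \<sigma>) \<delta>) = \<delta>" for \<delta>
    by (simp_all add: conj_action_def fun_eq_iff inv_inv_eq[OF b] inv)
  then have "bij_betw (conj_action \<sigma>) derivations derivations"
    by (intro bij_betw_byWitness[where f' = "conj_action (inv \<sigma>)"])
      (auto simp: conj_action_derivation \<sigma> poly_automorphisms_inv)
  then show ?thesis
    by (simp add: lie_automorphisms_def conj_action_def fun_eq_iff escale_def commutator_def
        hom minus inv)
qed

section \<open>Maximality\<close>

text \<open>As long as some partial derivative is non-constant, replacing \<open>p\<close> by it
  stays in \<open>V\<close> and lowers the degree bound.\<close>

lemma exists_degree_one: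
  fixes p :: "('n::finite, 'k::field_char_0) mpoly"
  assumes V: "\<And>i p. p \<in> V \<Longrightarrow> partial_deriv i p \<in> V"
    and p: "p \<in> V" "p \<notin> range const"
  obtains q where "q \<in> V" "q \<notin> range const" "\<And>i. partial_deriv i q \<in> range const"
proof -
  let ?deg = "\<lambda>m::'n \<Rightarrow>\<^sub>0 nat. \<Sum>i\<in>UNIV. poly_mapping.lookup m i"
  have "\<exists>q\<in>V. q \<notin> range const \<and> (\<forall>i. partial_deriv i q \<in> range const)"
    if "p \<in> V" "p \<notin> range const" "\<And>m. poly_mapping.lookup p m \<noteq> 0 \<Longrightarrow> ?deg m \<le> s" for s p
    using that
  proof (induction s arbitrary: p rule: less_induct)
    case (less s)
    show ?case
    proof (cases "\<forall>i. partial_deriv i p \<in> range const")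
      case False
      then obtain i where i: "partial_deriv i p \<notin> range const" by blast
      have deg: "?deg m < s" if "poly_mapping.lookup (partial_deriv i p) m \<noteq> 0" for m
      proof -
        have "poly_mapping.lookup p (m + Poly_Mapping.single i 1) \<noteq> 0"
          using that by (auto simp: lookup_partial_deriv)
        from less.prems(3)[OF this] show ?thesis
          by (simp add: lookup_add lookup_single when_def sum.distrib)
      qed
      \<comment> \<open>A nonzero derivative has a monomial of degree below \<open>s\<close>, so
        \<open>s\<close> is positive and \<open>s - 1\<close> is really smaller.\<close>
      have "partial_deriv i p \<noteq> 0"
        using i by (metis rangeI single_zero const_def)
      then obtain m where "poly_mapping.lookup (partial_deriv i p) m \<noteq> 0"
        by (metis lookup_zero poly_mapping_eqI)
      with deg have "s > 0" by fastforce
      then show ?thesis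
        using less.IH[of "s - 1" "partial_deriv i p"] V[OF less.prems(1)] i deg
        by (metis One_nat_def Suc_pred diff_less less_Suc_eq_le zero_less_one)
    qed (use less.prems in blast)
  qed
  moreover have "?deg m \<le> (\<Sum>m\<in>Poly_Mapping.keys p. ?deg m)" if "poly_mapping.lookup p m \<noteq> 0" for m
    using that by (intro member_le_sum) (auto simp: in_keys_iff)
  ultimately show ?thesis
    using p that by blast
qed

lemma divergence_free_submodule_UNIV:
  fixes V :: "('n::finite, 'k::field_char_0) mpoly set"
  assumes card: "CARD('n) \<ge> 2"
    and add: "\<And>p q. p \<in> V \<Longrightarrow> q \<in> V \<Longrightarrow> p + q \<in> V"
    and scale: "\<And>c p. p \<in> V \<Longrightarrow> pscale c p \<in> V"
    and act: "\<And>f p. f \<in> derivations \<Longrightarrow> divergence f = 0 \<Longrightarrow> p \<in> V \<Longrightarrow> f p \<in> V"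
    and p: "p \<in> V" "p \<notin> range const"
  shows "V = UNIV"
proof -
  have act': "u * partial_deriv i q \<in> V" if "partial_deriv i u = 0" "q \<in> V" for u i q
    using act[OF mult_partial_deriv_derivation, of u i q] that
    by (simp add: divergence_mult_partial_deriv)
  have other: "\<exists>j. j \<noteq> i" for i :: 'n
  proof (rule ccontr)
    assume "\<not> ?thesis"
    then have "UNIV = {i}" by auto
    then have "CARD('n) = 1" by (metis card_1_singleton_iff One_nat_def)
    with card show False by simp
  qed
  obtain q where q: "q \<in> V" "q \<notin> range const" "\<And>i. partial_deriv i q \<in> range const"
    using exists_degree_one[OF _ p] act[OF partial_deriv_derivation divergence_partial_deriv]
    by metis
  then obtain i where i: "partial_deriv i q \<noteq> 0" by (auto simp: range_const_iff)
  obtain c where c: "partial_deriv i q = const c" using q(3) by blast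
  have "c \<noteq> 0" using i c by (auto simp: const_def)
  \<comment> \<open>The field \<open>var j * partial_deriv i\<close> is divergence-free only for
    \<open>j \<noteq> i\<close>; the variable \<open>i\<close> itself is then reached from another
    variable \<open>l\<close>.\<close>
  have var_j: "var j \<in> V" if "j \<noteq> i" for j
  proof -
    have "var j * partial_deriv i q \<in> V"
      using that q(1) by (intro act') (simp add: partial_deriv_var)
    then have "pscale c (var j) \<in> V"
      by (simp add: c pscale_def mult.commute)
    from scale[OF this, of "inverse c"] show ?thesis
      using \<open>c \<noteq> 0\<close> by simp
  qed
  have var: "var j \<in> V" for j
  proof (cases "j = i")
    case True
    obtain l where l: "l \<noteq> i" using other by blast
    have "var i * partial_deriv l (var l) \<in> V"
      using l by (intro act' var_j) (simp_all add: partial_deriv_var)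
    then show ?thesis by (simp add: True partial_deriv_var)
  qed (rule var_j)
  have "r \<in> V" for r
  proof (induction r rule: mpoly_induct)
    case (add p q)
    then show ?case by (rule assms(2))
  next
    case (single m c)
    \<comment> \<open>The monomial arises in two moves. A field along another variable
      \<open>l\<close> yields the power \<open>Suc k\<close> of the variable \<open>j\<close>; then
      a field along \<open>j\<close> lowers it to \<open>k\<close>, its factor \<open>?u\<close>
      supplying the other variables and cancelling the factor \<open>Suc k\<close> of the
      derivative.\<close>
    obtain j :: 'n where True by blast
    obtain l where l: "l \<noteq> j" using other by blast
    define k where "k = poly_mapping.lookup m j"
    let ?x = "\<lambda>k. Poly_Mapping.single (Poly_Mapping.single j k) (1::'k)"
    let ?u = "Poly_Mapping.single (m - Poly_Mapping.single j k) (c / of_nat (Suc k))"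
    have "?x (Suc k) * partial_deriv l (var l) \<in> V"
      using l by (intro act' var) (simp add: partial_deriv_single lookup_single)
    then have "?x (Suc k) \<in> V" by (simp add: partial_deriv_var)
    then have "?u * partial_deriv j (?x (Suc k)) \<in> V"
      by (intro act') (simp_all add: partial_deriv_single lookup_minus k_def)
    also have "m - Poly_Mapping.single j k + Poly_Mapping.single j k = m"
      by (rule poly_mapping_eqI)
        (auto simp: k_def lookup_add lookup_minus lookup_single when_def)
    then have "?u * partial_deriv j (?x (Suc k)) = Poly_Mapping.single m c"
      by (simp add: partial_deriv_single mult_single single_diff[symmetric] del: of_nat_Suc)
    finally show ?case .
  qed
  then show ?thesis by blast
qed

text \<open>The divergence is twice the variable \<open>z\<close>, which is non-constant in
  characteristic zero.\<close>

lemma exists_not_const_div: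
  "(\<lambda>p. var z * var z * partial_deriv z p) \<in> derivations - const_div_derivations"
proof -
  have "partial_deriv z (partial_deriv z (var z * var z)) \<noteq> (0 :: ('a, 'b) mpoly)"
    by (simp add: partial_deriv_simps)
  then show ?thesis
    by (auto simp: const_div_derivations_iff range_const_iff mult_partial_deriv_derivation
        divergence_mult_partial_deriv)
qed

lemma maximal_const_div:
  assumes "CARD('n) \<ge> 2"
  shows "maximal_lie_subalgebra const_div_derivations
    (derivations :: ('n::finite, 'k::field_char_0) mpoly_endo set)"
  unfolding maximal_lie_subalgebra_def
proof (intro conjI allI impI)
  show "lie_subalgebra const_div_derivations derivations"
    by (rule lie_subalgebra_const_div)
  show "const_div_derivations \<noteq> (derivations :: ('n, 'k) mpoly_endo set)"
    using exists_not_const_div[of "undefined :: 'n", where 'b = 'k] by auto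
next
  fix N :: "('n, 'k) mpoly_endo set"
  assume N: "lie_subalgebra N derivations \<and> const_div_derivations \<subset> N"
  then have sub: "N \<subseteq> derivations" "const_div_derivations \<subseteq> N" and
    subspace: "endo_space.subspace N" and
    comm: "\<And>f g. f \<in> N \<Longrightarrow> g \<in> N \<Longrightarrow> commutator f g \<in> N"
    by (auto simp: lie_subalgebra_def)
  obtain h where h: "h \<in> N" "h \<notin> const_div_derivations" using N by blast
  \<comment> \<open>A larger subalgebra realizes every polynomial as a divergence; \<open>h\<close>
    supplies a non-constant one to start from.\<close>
  have "divergence ` N = UNIV"
  proof (rule divergence_free_submodule_UNIV[OF assms])
    show "p + q \<in> divergence ` N" if pq: "p \<in> divergence ` N" "q \<in> divergence ` N" for p q
    proof -
      obtain f g where "p = divergence f" "q = divergence g" "f \<in> N" "g \<in> N"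
        using pq by blast
      then show ?thesis
        by (intro image_eqI[of _ _ "f + g"] endo_space.subspace_add[OF subspace])
          (simp_all only: divergence_add)
    qed
    show "pscale c p \<in> divergence ` N" if p: "p \<in> divergence ` N" for c p
    proof -
      obtain f where "p = divergence f" "f \<in> N"
        using p by blast
      then show ?thesis
        by (intro image_eqI[of _ _ "escale c f"] endo_space.subspace_scale[OF subspace])
          (simp_all only: divergence_escale)
    qed
    show "divergence h \<in> divergence ` N" using h by blast
    show "divergence h \<notin> range const"
      using h sub by (auto simp: const_div_derivations_iff)
    show "f p \<in> divergence ` N"
      if f: "f \<in> derivations" "divergence f = 0" and p: "p \<in> divergence ` N" for f p
    proof -
      obtain g where g: "g \<in> N" "p = divergence g" using p by blast
      then have gd: "g \<in> derivations" using sub by blast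
      \<comment> \<open>For divergence-free \<open>f\<close>, acting on a divergence amounts to
        taking the divergence of a bracket.\<close>
      have "f p = divergence (commutator f g)"
        by (simp add: divergence_commutator[OF f(1) gd] f(2) g(2) derivation_0[OF gd])
      moreover have "commutator f g \<in> N"
        using sub(2) f g(1) divergence_free_const_div by (intro comm) blast+
      ultimately show ?thesis by blast
    qed
  qed
  \<comment> \<open>A field of \<open>N\<close> with the same divergence differs from
    \<open>f\<close> by a divergence-free one, which already lies in \<open>N\<close>.\<close>
  then have "f \<in> N" if f: "f \<in> derivations" for f
  proof -
    obtain g where g: "g \<in> N" "divergence f = divergence g"
      using \<open>divergence ` N = UNIV\<close> by (metis UNIV_I imageE)
    then have "divergence (f - g) = 0"
      by (simp only: divergence_diff diff_self)
    moreover have "f - g \<in> derivations"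
      using sub(1) g(1) by (intro derivation_diff f) blast
    ultimately have "f - g \<in> N"
      using sub(2) divergence_free_const_div by blast
    then have "(f - g) + g \<in> N"
      by (rule endo_space.subspace_add[OF subspace]) (rule g(1))
    then show ?thesis by (simp only: diff_add_cancel)
  qed
  then show "N = derivations" using sub by blast
qed

lemma escale_apply: "escale c f p = pscale c (f p)"
  by (simp only: escale_def)

text \<open>In one variable the vector fields with coefficients of degree at most 2, a copy of
  \<open>sl\<^sub>2\<close>, lie strictly between.\<close>

lemma not_maximal_const_div:
  assumes "CARD('n) = 1"
  shows "\<not> maximal_lie_subalgebra const_div_derivations
    (derivations :: ('n::finite, 'k::field_char_0) mpoly_endo set)"
proof -
  obtain z :: 'n where z: "UNIV = {z}" using assms by (rule card_1_singletonE)
  let ?d = "partial_deriv z :: ('n, 'k) mpoly_endo"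
  let ?N = "{f \<in> derivations. ?d (?d (?d (f (var z)))) = 0}"
  have apply_z: "f p = f (var z) * ?d p" if "f \<in> derivations" for f p
    using derivation_apply[OF that, of p] by (simp add: z)
  have comm: "commutator f g (var z) = f (var z) * ?d (g (var z)) - g (var z) * ?d (f (var z))"
    if "f \<in> derivations" "g \<in> derivations" for f g
    by (simp only: commutator_apply apply_z[OF that(1), of "g (var z)"]
        apply_z[OF that(2), of "f (var z)"])
  have div: "divergence f = ?d (f (var z))" for f :: "('n, 'k) mpoly_endo"
    by (simp add: divergence_def z)
  have sub: "lie_subalgebra ?N derivations"
    unfolding lie_subalgebra_def endo_space.subspace_def
  proof (intro conjI ballI allI)
    show "?N \<subseteq> derivations" by blast
    show "0 \<in> ?N"
      by (simp add: derivation_0_closed partial_deriv_simps)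
    show "f + g \<in> ?N" if "f \<in> ?N" "g \<in> ?N" for f g
      using that derivation_plus_closed[of f g]
      by (simp only: mem_Collect_eq plus_fun_apply partial_deriv_add add_0_left)
    show "escale c f \<in> ?N" if "f \<in> ?N" for c f
      using that derivation_escale_closed[of f c]
      by (simp only: mem_Collect_eq escale_apply partial_deriv_pscale poly_space.scale_zero_right)
    show "commutator f g \<in> ?N" if "f \<in> ?N" "g \<in> ?N" for f g
    proof -
      have d: "f \<in> derivations" "g \<in> derivations" using that by auto
      \<comment> \<open>If \<open>a\<close> and \<open>b\<close> have zero third derivative, the
        second derivative of \<open>a b' - b a'\<close> is \<open>a' b'' - b' a''\<close>, whose
        derivative vanishes as well.\<close>
      have "?d (?d (?d (f (var z) * ?d (g (var z)) - g (var z) * ?d (f (var z))))) = 0"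
        using that by (simp add: partial_deriv_simps)
      then show ?thesis
        using derivation_commutator_closed[OF d] by (simp only: mem_Collect_eq comm[OF d])
    qed
  qed
  have lower: "const_div_derivations \<subseteq> ?N"
    by (auto simp: const_div_derivations_iff range_const_iff div partial_deriv_simps)
  have strict: "(\<lambda>p. var z * var z * ?d p) \<in> ?N - const_div_derivations"
    using exists_not_const_div[of z] by (auto simp: partial_deriv_simps)
  \<comment> \<open>The cube of the variable has third derivative 6, nonzero in characteristic
    zero.\<close>
  have upper: "(\<lambda>p. var z * var z * var z * ?d p) \<in> derivations - ?N"
    by (simp add: mult_partial_deriv_derivation partial_deriv_simps)
  have proper: "const_div_derivations \<subset> ?N"
    using strict by (intro psubsetI lower notI) (simp only: Diff_cancel empty_iff)
  show ?thesis
  proof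
    assume "maximal_lie_subalgebra const_div_derivations (derivations :: ('n, 'k) mpoly_endo set)"
    then have "\<forall>N. lie_subalgebra N derivations \<and> const_div_derivations \<subset> N \<longrightarrow>
        N = (derivations :: ('n, 'k) mpoly_endo set)"
      unfolding maximal_lie_subalgebra_def by (elim conjE)
    from this[rule_format, OF conjI[OF sub proper]] show False
      using upper by (simp only: Diff_cancel empty_iff)
  qed
qed

theorem proposition2p21:
  fixes D divc :: "('n::finite, 'k::field_char_0) mpoly_endo set"
  defines "D \<equiv> derivations" and "divc \<equiv> const_div_derivations"
  shows "(CARD('n) \<ge> 2 \<longrightarrow> maximal_lie_subalgebra divc D) \<and>
    (CARD('n) = 1 \<longrightarrow> \<not> maximal_lie_subalgebra divc D) \<and>
    lie_subalgebra divc D \<and>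
    (\<forall>\<phi>\<in>lie_automorphisms D. \<phi> ` divc = divc) \<and>
    (\<forall>\<sigma>\<in>poly_automorphisms. conj_action \<sigma> ` divc = divc)"
  unfolding D_def divc_def
  by (intro conjI impI ballI maximal_const_div not_maximal_const_div lie_subalgebra_const_div
      lie_aut_image_const_div conj_action_lie_automorphism)

end
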